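(* There is an absolute constant $c_0>0$, and for each integer $k\ge 2$ a constant $C_k>0$ depending only on $k$, such that the following holds. Let $G$ be an abelian group, $A\subseteq G$ a finite set, and $k$ an integer with $2\le k<\lfloor\log|A|\rfloor$. Suppose that $$\mathsf{T}_k(A)=c|A|^{2k-1}\ge 10^k|A|^k\log^{2k}|A|.$$ Then there is a set $A'\subseteq A$ such that $$|A'|\ge c_0\,\frac{c^{\frac1{k-1}}|A|}{\log^3|A|}\cdot\log\big(c^{\frac1{k-1}}|A|\big)$$ and $$\dim(A')\le C_k\,c^{-\frac1{2(k-1)}}\log^{3/2}|A|.$$
   Context: $\mathsf{T}_k(A)=|\{(a_1,\dots,a_k,a'_1,\dots,a'_k)\in A^{2k} : a_1+\dots+a_k=a'_1+\dots+a'_k\}|$. All logarithms are to base $2$. A finite subset $\Lambda$ of an abelian group is dissociated if $\sum_{\lambda\in\Lambda}\varepsilon_\lambda\lambda=0$ with all $\varepsilon_\lambda\in\{-1,0,1\}$ implies $\varepsilon_\lambda=0$ for all $\lambda$ (the empty set is dissociated). For a finite set $B$, $\dim(B)$ is the maximal cardinality of a dissociated subset of $B$. *)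

theory Defs
  imports "HOL-Algebra.Algebra" "HOL-Library.FuncSet" Complex_Main
begin

text \<open>
  Abelian groups are \<^locale>\<open>comm_group\<close> structures, so the group law is written
  multiplicatively: a sum of group elements is a \<^const>\<open>finprod\<close>, and an integer multiple is
  a power with integer exponent.
\<close>

definition T_energy :: "('a, 'm) monoid_scheme \<Rightarrow> nat \<Rightarrow> 'a set \<Rightarrow> nat" where
  "T_energy G k A =
     card {(a, a'). a \<in> {1..k} \<rightarrow>\<^sub>E A \<and> a' \<in> {1..k} \<rightarrow>\<^sub>E A \<and>
                    finprod G a {1..k} = finprod G a' {1..k}}"

definition dissociated :: "('a, 'm) monoid_scheme \<Rightarrow> 'a set \<Rightarrow> bool" where
  "dissociated G \<Lambda> \<longleftrightarrow> finite \<Lambda> \<and> \<Lambda> \<subseteq> carrier G \<and>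
     (\<forall>\<epsilon> :: 'a \<Rightarrow> int. (\<forall>x\<in>\<Lambda>. \<epsilon> x \<in> {-1, 0, 1}) \<longrightarrow>
        finprod G (\<lambda>x. x [^]\<^bsub>G\<^esub> \<epsilon> x) \<Lambda> = \<one>\<^bsub>G\<^esub> \<longrightarrow>
        (\<forall>x\<in>\<Lambda>. \<epsilon> x = 0))"

text \<open>Only meaningful for finite \<open>B\<close>; the maximum is then over a finite set, which contains
  \<open>card {}\<close> since the empty set is dissociated.\<close>

definition add_dim :: "('a, 'm) monoid_scheme \<Rightarrow> 'a set \<Rightarrow> nat" where
  "add_dim G B = Max (card ` {\<Lambda>. \<Lambda> \<subseteq> B \<and> dissociated G \<Lambda>})"

text \<open>
  The constants \<open>c0\<close> and \<open>C k\<close> work for all abelian groups whose carrier is a set of elements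
  of type \<open>'a\<close>. HOL cannot quantify over types inside a formula, so an existential over \<open>c0\<close> and
  \<open>C\<close> in front of this predicate at a type variable \<open>'a\<close> would let the constants depend on \<open>'a\<close>.
  Absolute constants are expressed instead by two facts: positive constants exist at the fixed
  type \<open>nat\<close> (a statement without type variables), and any constants valid at \<open>nat\<close> are valid at
  every type \<open>'a\<close>.
\<close>

definition bounds_hold :: "'a itself \<Rightarrow> real \<Rightarrow> (nat \<Rightarrow> real) \<Rightarrow> bool" where
  "bounds_hold _ c0 C \<longleftrightarrow>
     (\<forall>(G :: 'a monoid) (A :: 'a set) (k :: nat) (c :: real).
        comm_group G \<longrightarrow> A \<subseteq> carrier G \<longrightarrow> finite A \<longrightarrow>
        2 \<le> k \<longrightarrow> int k < \<lfloor>log 2 (real (card A))\<rfloor> \<longrightarrow>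
        real (T_energy G k A) = c * real (card A) ^ (2 * k - 1) \<longrightarrow>
        c * real (card A) ^ (2 * k - 1)
          \<ge> 10 ^ k * real (card A) ^ k * log 2 (real (card A)) ^ (2 * k) \<longrightarrow>
        (\<exists>A' \<subseteq> A.
           real (card A') \<ge>
             c0 * (c powr (1 / (real k - 1)) * real (card A) / log 2 (real (card A)) ^ 3)
                * log 2 (c powr (1 / (real k - 1)) * real (card A)) \<and>
           real (add_dim G A') \<le>
             C k * c powr (- (1 / (2 * (real k - 1)))) * log 2 (real (card A)) powr (3 / 2)))"

end

theory Submission
  imports Defs "HOL-Analysis.Convex"
begin

text \<open>
  Draw \<open>r\<close> letters independently from \<open>A\<close> and as many from \<open>A\<^sup>-\<^sup>1\<close>. Suppose that every set \<open>R\<close> of at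
  most \<open>2 r\<close> elements has a span (products of at most \<open>4 p\<close> elements with exponents 1 or -1) that
  contains fewer than \<open>|A| / (2 r)\<close> elements of \<open>A\<close>. Then a letter rarely lies in the span of the
  earlier ones. If no letter does, every group element is the product of at most one
  sublist of length \<open>2 p\<close>, and each exceptional letter at most doubles this number, so the
  expected number of relations with \<open>p\<close> letters from each half is bounded. On the other hand
  it equals \<open>(r choose p)\<^sup>2 T\<^sub>p(A) / |A|\<^bsup>2 p\<^esup>\<close>, where \<open>T\<^sub>p\<close> is bounded below in terms of \<open>T\<^sub>k\<close>
  because the energies are log-convex. With \<open>p\<close> close to \<open>log |A|\<close> and \<open>r\<close> a large multiple of
  \<open>p c\<^bsup>-1/(2(k-1))\<^esup>\<close> this is a contradiction. Hence some span meets \<open>A\<close> in a large set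
  \<open>A'\<close>; comparing the \<open>2 ^ d\<close> subset products of a dissociated set of size \<open>d\<close> in \<open>A'\<close> with the
  number of words of bounded length in \<open>R\<close> bounds \<open>d\<close>.

  An arbitrary abelian group is reduced to one on \<open>nat\<close> through the countable subgroup
  generated by \<open>A\<close>.
\<close>

section \<open>Words over finite sets\<close>

lemma listset_Cons_image: "listset (B # Bs) = (\<lambda>(y, w). y # w) ` (B \<times> listset Bs)"
  by (auto simp: set_Cons_def)

lemma finite_listset: "(\<And>B. B \<in> set Bs \<Longrightarrow> finite B) \<Longrightarrow> finite (listset Bs)"
  by (induction Bs) (auto simp: listset_Cons_image simp del: listset.simps(2))

text \<open>Splitting off the first letter drives the inductions over words. Alphabets may differ
  from position to position because the words used later have one half over \<open>A\<close> and the
  other over the inverses of \<open>A\<close>.\<close>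

lemma sum_listset_Cons:
  "(\<Sum>w\<in>listset (B # Bs). F w) = (\<Sum>y\<in>B. \<Sum>w\<in>listset Bs. F (y # w))"
proof -
  have "inj_on (\<lambda>(y, w). y # w) (B \<times> listset Bs)"
    by (auto simp: inj_on_def)
  then show ?thesis
    unfolding listset_Cons_image by (simp add: sum.reindex sum.cartesian_product case_prod_unfold)
qed

lemma listset_replicate: "listset (replicate k B) = {w. length w = k \<and> set w \<subseteq> B}"
proof (induction k)
  case (Suc k)
  show ?case
  proof (rule set_eq_iff[THEN iffD2], rule allI)
    fix w show "w \<in> listset (replicate (Suc k) B) \<longleftrightarrow> w \<in> {w. length w = Suc k \<and> set w \<subseteq> B}"
      using Suc by (cases w) (auto simp: set_Cons_def)
  qed
qed auto

lemma card_listset_replicate: "finite B \<Longrightarrow> card (listset (replicate k B)) = card B ^ k"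
  using card_lists_length_eq[of B k] by (simp add: listset_replicate conj_commute)

lemma length_listset: "w \<in> listset Bs \<Longrightarrow> length w = length Bs"
  by (induction Bs arbitrary: w) (auto simp: set_Cons_def)

lemma set_listset: "w \<in> listset Bs \<Longrightarrow> set w \<subseteq> \<Union> (set Bs)"
  by (induction Bs arbitrary: w) (fastforce simp: set_Cons_def)+

section \<open>Dependent letters and sublist products\<close>

context comm_group
begin

text \<open>Products of at most \<open>s\<close> entries of the list, each entry used at most once and with
  exponent 1 or -1.\<close>

primrec signed_span :: "'a list \<Rightarrow> nat \<Rightarrow> 'a set" where
  "signed_span [] s = {\<one>}"
| "signed_span (y # ys) s = signed_span ys s \<union>
     (case s of 0 \<Rightarrow> {}
      | Suc t \<Rightarrow> (\<lambda>h. h \<otimes> y) ` signed_span ys t \<union> (\<lambda>h. h \<otimes> inv y) ` signed_span ys t)"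

text \<open>This counts choices of \<open>s\<close> positions whose letters multiply to
  \<open>g\<close>. Positions are counted rather than letters, so repeated letters count with
  multiplicity.\<close>

primrec sublist_count :: "'a list \<Rightarrow> nat \<Rightarrow> 'a \<Rightarrow> nat" where
  "sublist_count [] s g = (if s = 0 \<and> g = \<one> then 1 else 0)"
| "sublist_count (y # ys) s g = sublist_count ys s g +
     (case s of 0 \<Rightarrow> 0 | Suc t \<Rightarrow> sublist_count ys t (g \<otimes> inv y))"

text \<open>Reading a word from right to left, a letter is dependent if it lies in the span of the
  free letters read before it.\<close>

primrec free_part :: "nat \<Rightarrow> 'a list \<Rightarrow> 'a list" where
  "free_part q [] = []"
| "free_part q (y # ys) =
     (if y \<in> signed_span (free_part q ys) q then free_part q ys else y # free_part q ys)"

primrec dependent_part :: "nat \<Rightarrow> 'a list \<Rightarrow> 'a list" where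
  "dependent_part q [] = []"
| "dependent_part q (y # ys) =
     (if y \<in> signed_span (free_part q ys) q then y # dependent_part q ys else dependent_part q ys)"

lemma set_free_part: "set (free_part q ys) \<subseteq> set ys"
  by (induction ys) auto

lemma set_dependent_part: "set (dependent_part q ys) \<subseteq> set ys"
  by (induction ys) auto

lemma length_free_part: "length (free_part q ys) \<le> length ys"
  by (induction ys) auto

lemma signed_span_closed: "set ys \<subseteq> carrier G \<Longrightarrow> signed_span ys s \<subseteq> carrier G"
proof (induction ys arbitrary: s)
  case (Cons y ys)
  have "signed_span ys t \<subseteq> carrier G" for t
    using Cons by auto
  then show ?case
    using Cons.prems by (cases s) auto
qed simp

lemma signed_span_mono: "s \<le> s' \<Longrightarrow> signed_span ys s \<subseteq> signed_span ys s'"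
proof (induction ys arbitrary: s s')
  case (Cons y ys)
  have "signed_span ys s \<subseteq> signed_span ys s'" and "signed_span ys (s - 1) \<subseteq> signed_span ys (s' - 1)"
    using Cons.IH[of s s'] Cons.IH[of "s - 1" "s' - 1"] Cons.prems by auto
  then show ?case
    using Cons.prems by (auto split: nat.split)
qed simp

text \<open>Both exponents 1 and -1 are allowed, so the span is symmetric. This later carries a
  bound for \<open>A\<close> over to the set of its inverses.\<close>

lemma signed_span_inv:
  assumes "set ys \<subseteq> carrier G" "g \<in> signed_span ys s"
  shows "inv g \<in> signed_span ys s"
  using assms
proof (induction ys arbitrary: s g)
  case (Cons y ys)
  have y: "y \<in> carrier G" and ys: "set ys \<subseteq> carrier G"
    using Cons.prems by auto
  show ?case
  proof (cases "g \<in> signed_span ys s")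
    case True
    then show ?thesis using Cons.IH ys by simp
  next
    case False
    then obtain t h where t: "s = Suc t" "h \<in> signed_span ys t" "g = h \<otimes> y \<or> g = h \<otimes> inv y"
      using Cons.prems(2) by (auto split: nat.splits)
    have h: "h \<in> carrier G" "inv h \<in> signed_span ys t"
      using signed_span_closed[OF ys] t Cons.IH[OF ys] by auto
    have "inv g = inv h \<otimes> inv y \<or> inv g = inv h \<otimes> y"
      using t h y by (auto simp: inv_mult)
    then show ?thesis using h t by auto
  qed
qed simp

text \<open>In the quotient a position used by both sublists cancels, and a position used by only
  one keeps exponent 1 or -1. So every exponent stays in {-1, 0, 1} and at most
  \<open>s + s'\<close> positions are used.\<close>

lemma signed_span_quotient:
  assumes "set ys \<subseteq> carrier G" "g \<in> carrier G" "g' \<in> carrier G"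
    and "sublist_count ys s g > 0" "sublist_count ys s' g' > 0"
  shows "g \<otimes> inv g' \<in> signed_span ys (s + s')"
  using assms
proof (induction ys arbitrary: s s' g g')
  case (Cons y ys)
  have y: "y \<in> carrier G" and ys: "set ys \<subseteq> carrier G"
    using Cons.prems by auto
  note IH = Cons.IH[OF ys]
  have g: "sublist_count ys s g > 0 \<or> (\<exists>t. s = Suc t \<and> sublist_count ys t (g \<otimes> inv y) > 0)"
    using Cons.prems(4) by (auto split: nat.splits)
  have g': "sublist_count ys s' g' > 0 \<or> (\<exists>t. s' = Suc t \<and> sublist_count ys t (g' \<otimes> inv y) > 0)"
    using Cons.prems(5) by (auto split: nat.splits)
  have cancel: "g \<otimes> inv y \<otimes> inv g' \<otimes> y = g \<otimes> inv g'"
    using Cons.prems(2,3) y by (metis inv_closed inv_solve_right m_closed m_comm m_assoc)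
  have inv_quot: "inv (g' \<otimes> inv y) = inv g' \<otimes> y"
    using Cons.prems(2,3) y by (simp add: inv_mult)
  consider (a) "sublist_count ys s g > 0" "sublist_count ys s' g' > 0"
    | (b) t where "s = Suc t" "sublist_count ys t (g \<otimes> inv y) > 0" "sublist_count ys s' g' > 0"
    | (c) t where "sublist_count ys s g > 0" "s' = Suc t" "sublist_count ys t (g' \<otimes> inv y) > 0"
    | (d) t t' where "s = Suc t" "sublist_count ys t (g \<otimes> inv y) > 0"
        "s' = Suc t'" "sublist_count ys t' (g' \<otimes> inv y) > 0"
    using g g' by metis
  then show ?case
  proof cases
    case a
    then show ?thesis using IH Cons.prems by simp
  next
    case b
    then have "(g \<otimes> inv y) \<otimes> inv g' \<in> signed_span ys (t + s')"
      using IH Cons.prems y by simp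
    moreover have "g \<otimes> inv g' = ((g \<otimes> inv y) \<otimes> inv g') \<otimes> y"
      using cancel by simp
    ultimately show ?thesis using b by auto
  next
    case c
    then have "g \<otimes> inv (g' \<otimes> inv y) \<in> signed_span ys (s + t)"
      using IH Cons.prems y by simp
    moreover have "g \<otimes> inv g' = (g \<otimes> inv (g' \<otimes> inv y)) \<otimes> inv y"
      using Cons.prems(2,3) y inv_quot by (metis inv_closed m_assoc m_closed r_inv r_one)
    ultimately show ?thesis using c by auto
  next
    case d
    then have "(g \<otimes> inv y) \<otimes> inv (g' \<otimes> inv y) \<in> signed_span ys (t + t')"
      using IH Cons.prems y by simp
    moreover have "g \<otimes> inv g' = (g \<otimes> inv y) \<otimes> inv (g' \<otimes> inv y)"
      unfolding inv_quot using Cons.prems(2,3) y cancel by (metis inv_closed m_assoc m_closed)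
    ultimately show ?thesis
      using d signed_span_mono[of "t + t'" "s + s'" ys] by auto
  qed
qed (auto split: if_splits)

text \<open>By induction there is at most one representation of \<open>g\<close> that uses a new
  free letter \<open>y\<close> and at most one that avoids it. If both existed, their quotient would
  place \<open>y\<close> in the span of the earlier free letters with
  \<open>s + (s - 1) \<le> q\<close> factors, contradicting freeness.\<close>

lemma sublist_count_free_part_le_1:
  assumes "set ys \<subseteq> carrier G" "g \<in> carrier G" "2 * s \<le> q"
  shows "sublist_count (free_part q ys) s g \<le> 1"
  using assms
proof (induction ys arbitrary: s g)
  case (Cons y ys)
  let ?R = "free_part q ys"
  have y: "y \<in> carrier G" and ys: "set ys \<subseteq> carrier G"
    using Cons.prems by auto
  show ?case
  proof (cases "y \<in> signed_span ?R q")
    case True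
    then show ?thesis using Cons ys by simp
  next
    case False
    show ?thesis
    proof (cases s)
      case 0
      then show ?thesis using Cons ys False by simp
    next
      case (Suc t)
      have 1: "sublist_count ?R s g \<le> 1" "sublist_count ?R t (g \<otimes> inv y) \<le> 1"
        using Cons.IH[OF ys] Cons.prems Suc y by auto
      have "\<not> (sublist_count ?R s g > 0 \<and> sublist_count ?R t (g \<otimes> inv y) > 0)"
      proof
        assume *: "sublist_count ?R s g > 0 \<and> sublist_count ?R t (g \<otimes> inv y) > 0"
        have "set ?R \<subseteq> carrier G"
          using set_free_part ys by blast
        then have "g \<otimes> inv (g \<otimes> inv y) \<in> signed_span ?R (s + t)"
          using * Cons.prems y by (intro signed_span_quotient) auto
        moreover have "g \<otimes> inv (g \<otimes> inv y) = y"
          using Cons.prems y by (simp add: inv_mult m_assoc[symmetric])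
        ultimately show False
          using False signed_span_mono[of "s + t" q ?R] Cons.prems Suc by auto
      qed
      with 1 show ?thesis
        using Suc False by auto
    qed
  qed
qed simp

lemma sublist_count_move:
  assumes "set bs \<subseteq> carrier G" "y \<in> carrier G" "set ys \<subseteq> carrier G" "g \<in> carrier G"
  shows "sublist_count (bs @ y # ys) s g = sublist_count (y # bs @ ys) s g"
  using assms
proof (induction bs arbitrary: s g)
  case (Cons b bs)
  have "g \<otimes> inv b \<otimes> inv y = g \<otimes> inv y \<otimes> inv b"
    using Cons.prems by (simp add: m_ac)
  then show ?case
    using Cons by (auto split: nat.split)
qed simp

text \<open>In a commutative group the count does not depend on the order of the letters. Moving the
  dependent letters to the front isolates the free part, on which representations are
  unique.\<close>

lemma sublist_count_rearrange:
  assumes "set ys \<subseteq> carrier G" "g \<in> carrier G"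
  shows "sublist_count ys s g = sublist_count (dependent_part q ys @ free_part q ys) s g"
  using assms
proof (induction ys arbitrary: s g)
  case (Cons y ys)
  have "sublist_count (y # ys) s g
      = sublist_count (y # dependent_part q ys @ free_part q ys) s g"
    using Cons by (auto split: nat.split)
  moreover have "sublist_count (dependent_part q ys @ y # free_part q ys) s g
      = sublist_count (y # dependent_part q ys @ free_part q ys) s g"
    using Cons.prems set_dependent_part[of q ys] set_free_part[of q ys]
    by (intro sublist_count_move) auto
  ultimately show ?case
    by simp
qed simp

text \<open>Each letter of \<open>bs\<close> is either skipped or used, so it at most doubles the
  bound that holds for \<open>ys\<close>.\<close>

lemma sublist_count_append_le:
  assumes "set bs \<subseteq> carrier G" "g \<in> carrier G"
    and "\<And>t h. \<lbrakk>t \<le> s; h \<in> carrier G\<rbrakk> \<Longrightarrow> sublist_count ys t h \<le> 1"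
  shows "sublist_count (bs @ ys) s g \<le> 2 ^ length bs"
  using assms
proof (induction bs arbitrary: s g)
  case (Cons b bs)
  have "sublist_count (bs @ ys) s g \<le> 2 ^ length bs"
    using Cons by simp
  moreover have "sublist_count (bs @ ys) t (g \<otimes> inv b) \<le> 2 ^ length bs" if "s = Suc t" for t
    using Cons that by simp
  ultimately show ?case
    by (fastforce split: nat.split)
qed simp

text \<open>A free letter leaves the bound 1 on the number of representations intact, a dependent
  letter at most doubles it.\<close>

lemma sublist_count_le:
  assumes "set ys \<subseteq> carrier G" "g \<in> carrier G" "2 * s \<le> q"
  shows "sublist_count ys s g \<le> 2 ^ length (dependent_part q ys)"
  unfolding sublist_count_rearrange[OF assms(1,2), of s q]
  using assms set_dependent_part[of q ys]
  by (intro sublist_count_append_le sublist_count_free_part_le_1) auto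

text \<open>Whether the first letter is dependent is decided by the rest of the word. For a fixed
  rest at most \<open>z\<close> of the \<open>n\<close> letters are dependent, and these have double
  weight, so each position contributes a factor of at most \<open>n + z\<close>.\<close>

lemma sum_dependent_le:
  fixes m n :: nat and z :: real
  assumes "\<And>B. B \<in> set Bs \<Longrightarrow> finite B \<and> card B = n \<and> B \<subseteq> carrier G"
    and "\<And>B R. \<lbrakk>B \<in> set Bs; set R \<subseteq> carrier G; length R \<le> length Bs\<rbrakk>
           \<Longrightarrow> real (card (B \<inter> signed_span R q)) \<le> z"
  shows "(\<Sum>w\<in>listset Bs. 2 ^ length (dependent_part q w)) \<le> (real n + z) ^ length Bs"
  using assms
proof (induction Bs)
  case (Cons B Bs)
  have B: "finite B" "card B = n"
    using Cons.prems by auto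
  have z: "0 \<le> z"
    using Cons.prems(2)[of B "[]"] of_nat_0_le_iff[of "card (B \<inter> signed_span [] q)"]
    by (simp del: of_nat_0_le_iff signed_span.simps)
  have step: "(\<Sum>y\<in>B. 2 ^ length (dependent_part q (y # w)))
      \<le> (real n + z) * 2 ^ length (dependent_part q w)" if w: "w \<in> listset Bs" for w
  proof -
    let ?S = "signed_span (free_part q w) q" and ?d = "2 ^ length (dependent_part q w) :: real"
    have R: "set (free_part q w) \<subseteq> carrier G" "length (free_part q w) \<le> length (B # Bs)"
    proof -
      have "\<Union> (set Bs) \<subseteq> carrier G"
        using Cons.prems(1) by (simp add: Sup_le_iff)
      then show "set (free_part q w) \<subseteq> carrier G"
        using set_free_part[of q w] set_listset[OF w] by blast
      show "length (free_part q w) \<le> length (B # Bs)"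
        using length_free_part[of q w] length_listset[OF w] by simp
    qed
    have "(\<Sum>y\<in>B. 2 ^ length (dependent_part q (y # w)))
        = (\<Sum>y\<in>B. ?d + (if y \<in> ?S then ?d else 0))"
      by (intro sum.cong) auto
    also have "\<dots> = (real n + real (card (B \<inter> ?S))) * ?d"
      using B by (simp add: sum.distrib sum.If_cases algebra_simps)
    also have "\<dots> \<le> (real n + z) * ?d"
      using Cons.prems(2)[OF _ R] by (intro mult_right_mono) auto
    finally show ?thesis .
  qed
  have "(\<Sum>w\<in>listset (B # Bs). 2 ^ length (dependent_part q w) :: real)
      = (\<Sum>w\<in>listset Bs. \<Sum>y\<in>B. 2 ^ length (dependent_part q (y # w)))"
    by (subst sum_listset_Cons, rule sum.swap)
  also have "\<dots> \<le> (\<Sum>w\<in>listset Bs. (real n + z) * 2 ^ length (dependent_part q w))"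
    by (intro sum_mono step)
  also have "\<dots> = (real n + z) * (\<Sum>w\<in>listset Bs. 2 ^ length (dependent_part q w))"
    by (simp add: sum_distrib_left)
  also have "\<dots> \<le> (real n + z) * (real n + z) ^ length Bs"
    using z Cons.prems by (intro mult_left_mono Cons.IH) auto
  finally show ?case
    by simp
qed simp

section \<open>Energy as a sum over words\<close>

abbreviation word_prod :: "'a list \<Rightarrow> 'a" where
  "word_prod w \<equiv> foldr (\<otimes>) w \<one>"

lemma word_prod_closed: "set w \<subseteq> carrier G \<Longrightarrow> word_prod w \<in> carrier G"
  by (induction w) auto

text \<open>Only the choices with exactly \<open>p\<close> letters in the first block are counted.
  Their positions can be chosen in \<open>u choose p\<close> ways, the \<open>u - p\<close> skipped
  letters are arbitrary, and the used ones spell a word \<open>x\<close> that leaves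
  \<open>g \<otimes> inv (word_prod x)\<close> to be produced by the remaining blocks.\<close>

lemma sublist_count_sum_ge:
  assumes "finite B" "B \<subseteq> carrier G" "\<And>C. C \<in> set Bs \<Longrightarrow> finite C" "g \<in> carrier G" "p \<le> u"
  shows "(\<Sum>w\<in>listset (replicate u B @ Bs). sublist_count w (p + j) g)
     \<ge> (u choose p) * card B ^ (u - p) *
       (\<Sum>x\<in>listset (replicate p B). \<Sum>w\<in>listset Bs. sublist_count w j (g \<otimes> inv (word_prod x)))"
  using assms(4,5)
proof (induction u arbitrary: p g)
  case 0
  then show ?case by simp
next
  case (Suc u)
  let ?S = "\<lambda>p g. \<Sum>x\<in>listset (replicate p B). \<Sum>w\<in>listset Bs. sublist_count w j (g \<otimes> inv (word_prod x))"
  let ?T = "\<lambda>u i g. \<Sum>w\<in>listset (replicate u B @ Bs). sublist_count w i g"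
  have T_Suc: "?T (Suc u) i g = card B * ?T u i g +
      (case i of 0 \<Rightarrow> 0 | Suc i' \<Rightarrow> \<Sum>y\<in>B. ?T u i' (g \<otimes> inv y))" for i g
    unfolding replicate_Suc append_Cons sum_listset_Cons
    by (cases i) (simp_all add: sum.distrib)
  show ?case
  proof (cases p)
    case 0
    have "card B ^ u * ?S 0 g \<le> ?T u j g"
      using Suc.IH[of g 0] Suc.prems by simp
    then have "card B * (card B ^ u * ?S 0 g) \<le> card B * ?T u j g"
      by simp
    also have "\<dots> \<le> ?T (Suc u) j g"
      unfolding T_Suc by simp
    finally show ?thesis using 0 by (simp add: mult.assoc)
  next
    case (Suc p')
    have S_Suc: "?S p g = (\<Sum>y\<in>B. ?S p' (g \<otimes> inv y))"
      unfolding Suc replicate_Suc sum_listset_Cons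
    proof (intro sum.cong refl, goal_cases)
      case (1 y x w)
      then have "y \<in> carrier G" "word_prod x \<in> carrier G"
        using assms(2) word_prod_closed[of x] by (auto simp: listset_replicate)
      then have "g \<otimes> inv (y \<otimes> word_prod x) = g \<otimes> inv y \<otimes> inv (word_prod x)"
        using Suc.prems by (simp add: inv_mult m_ac)
      then show ?case by simp
    qed
    \<comment> \<open>In \<open>a\<close> the first letter of the block is skipped, in
      \<open>b\<close> it is used. Pascal's rule adds the two contributions.\<close>
    have a: "(u choose p) * card B ^ (Suc u - p) * ?S p g \<le> card B * ?T u (p + j) g"
    proof (cases "p \<le> u")
      case True
      have "card B * ((u choose p) * card B ^ (u - p) * ?S p g) \<le> card B * ?T u (p + j) g"
        using Suc.IH[of g p] Suc.prems True by (intro mult_left_mono) auto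
      then show ?thesis using True by (simp add: Suc_diff_le ac_simps)
    qed (simp add: binomial_eq_0)
    have b: "(u choose p') * card B ^ (Suc u - p) * ?S p g \<le> (\<Sum>y\<in>B. ?T u (p' + j) (g \<otimes> inv y))"
      unfolding S_Suc sum_distrib_left[where A = B]
    proof (intro sum_mono)
      fix y assume "y \<in> B"
      then show "(u choose p') * card B ^ (Suc u - p) * ?S p' (g \<otimes> inv y) \<le> ?T u (p' + j) (g \<otimes> inv y)"
        using Suc.IH[of "g \<otimes> inv y" p'] Suc.prems assms(2) Suc by auto
    qed
    have "(Suc u choose p) * card B ^ (Suc u - p) * ?S p g
       = (u choose p) * card B ^ (Suc u - p) * ?S p g + (u choose p') * card B ^ (Suc u - p) * ?S p g"
      unfolding Suc by (simp add: algebra_simps)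
    also have "\<dots> \<le> card B * ?T u (p + j) g + (\<Sum>y\<in>B. ?T u (p' + j) (g \<otimes> inv y))"
      using a b by (rule add_mono)
    also have "\<dots> = ?T (Suc u) (p + j) g"
      unfolding T_Suc using Suc by simp
    finally show ?thesis .
  qed
qed

text \<open>Taken over lists instead of functions, so that letters can be split off one at a time.
  \<open>T_energy_eq_word_energy\<close> identifies it with \<open>T_energy\<close>.\<close>

definition word_energy :: "nat \<Rightarrow> 'a set \<Rightarrow> nat" where
  "word_energy k A = (\<Sum>x\<in>listset (replicate k A). \<Sum>y\<in>listset (replicate k A).
     of_bool (word_prod x = word_prod y))"

lemma word_prod_map_inv:
  "set w \<subseteq> carrier G \<Longrightarrow> word_prod (map (\<lambda>x. inv x) w) = inv (word_prod w)"
  by (induction w) (auto simp: inv_mult word_prod_closed)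

text \<open>An equality of two \<open>p\<close>-letter products is a relation with \<open>p\<close>
  letters from \<open>A\<close> and \<open>p\<close> from the inverses. Each such relation occurs at
  \<open>(u choose p)\<^sup>2\<close> position patterns, with the other \<open>2 * (u - p)\<close>
  letters arbitrary.\<close>

lemma word_energy_le_sublist_count:
  assumes "finite A" "A \<subseteq> carrier G" "p \<le> u"
  shows "(u choose p)\<^sup>2 * card A ^ (2 * (u - p)) * word_energy p A \<le>
    (\<Sum>w\<in>listset (replicate u A @ replicate u (m_inv G ` A)). sublist_count w (2 * p) \<one>)"
proof -
  let ?I = "m_inv G ` A" and ?b = "(u choose p) * card A ^ (u - p)"
  have inj: "inj_on (m_inv G) A"
    using assms(2) by (metis inj_on_subset inv_inj)
  have I: "finite ?I" "?I \<subseteq> carrier G" "card ?I = card A"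
    using assms inj by (auto simp: card_image)
  have img: "listset (replicate p ?I) = map (m_inv G) ` listset (replicate p A)"
  proof (intro equalityI subsetI)
    fix w assume w: "w \<in> listset (replicate p ?I)"
    then have "map (m_inv G) w \<in> listset (replicate p A)" "map (m_inv G) (map (m_inv G) w) = w"
      using assms(2) by (fastforce simp: listset_replicate intro!: map_idI)+
    then show "w \<in> map (m_inv G) ` listset (replicate p A)"
      by (metis imageI)
  next
    fix w assume "w \<in> map (m_inv G) ` listset (replicate p A)"
    then show "w \<in> listset (replicate p ?I)"
      unfolding listset_replicate by fastforce
  qed
  have inj': "inj_on (map (m_inv G)) (listset (replicate p A))"
    by (rule inj_on_mapI, rule inj_on_subset[OF inj]) (auto simp: listset_replicate)
  have carr: "word_prod x \<in> carrier G" if "x \<in> listset (replicate p A)" for x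
    using that assms(2) word_prod_closed[of x] by (auto simp: listset_replicate)
  \<comment> \<open>The counting lemma is applied to the half with inverses first, with an empty
    tail, where \<open>sublist_count [] 0\<close> is the indicator of the identity. The end of the
    proof applies it to the other half, with this half as tail.\<close>
  have inner: "?b * (\<Sum>y\<in>listset (replicate p A). of_bool (g = word_prod y))
       \<le> (\<Sum>w\<in>listset (replicate u ?I). sublist_count w p (inv g))" if g: "g \<in> carrier G" for g
  proof -
    have "(\<Sum>y\<in>listset (replicate p A). of_bool (g = word_prod y))
        = (\<Sum>x\<in>listset (replicate p ?I). sublist_count [] 0 (inv g \<otimes> inv (word_prod x)))"
      unfolding img sum.reindex[OF inj'] o_def
    proof (intro sum.cong refl)
      fix y assume y: "y \<in> listset (replicate p A)"
      then have "word_prod (map (m_inv G) y) = inv (word_prod y)"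
        using assms(2) by (intro word_prod_map_inv) (auto simp: listset_replicate)
      then have "inv g \<otimes> inv (word_prod (map (m_inv G) y)) = inv g \<otimes> word_prod y"
        using carr[OF y] by simp
      moreover have "inv g \<otimes> word_prod y = \<one> \<longleftrightarrow> g = word_prod y"
        using carr[OF y] g by (metis inv_equality inv_inv inv_closed l_inv m_comm)
      ultimately show "of_bool (g = word_prod y)
          = sublist_count [] 0 (inv g \<otimes> inv (word_prod (map (m_inv G) y)))"
        by simp
    qed
    then show ?thesis
      using sublist_count_sum_ge[of ?I "[]" "inv g" p u 0] I g assms(3) by simp
  qed
  have scale: "?b * (?b * sum f S) = ?b * (\<Sum>x\<in>S. ?b * f x)" for f and S :: "'a list set"
    by (simp add: sum_distrib_left)
  have "(u choose p)\<^sup>2 * card A ^ (2 * (u - p)) * word_energy p A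
      = ?b * (?b * (\<Sum>x\<in>listset (replicate p A).
          (\<Sum>y\<in>listset (replicate p A). of_bool (word_prod x = word_prod y))))"
    unfolding word_energy_def
    by (simp add: power2_eq_square power_add[symmetric] mult_2 mult.assoc mult.left_commute)
  also have "\<dots> = ?b * (\<Sum>x\<in>listset (replicate p A).
          ?b * (\<Sum>y\<in>listset (replicate p A). of_bool (word_prod x = word_prod y)))"
    by (rule scale)
  also have "\<dots> \<le> ?b * (\<Sum>x\<in>listset (replicate p A). \<Sum>w\<in>listset (replicate u ?I).
      sublist_count w p (\<one> \<otimes> inv (word_prod x)))"
    using inner carr by (intro mult_left_mono sum_mono) auto
  also have "\<dots> \<le> (\<Sum>w\<in>listset (replicate u A @ replicate u ?I). sublist_count w (p + p) \<one>)"
    using assms I by (intro sublist_count_sum_ge) auto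
  finally show ?thesis
    by (simp add: mult_2)
qed

text \<open>This compares the two counts of relations with \<open>2 * p\<close> letters in words of
  length \<open>2 * u\<close>. The span parameter \<open>4 * p\<close> is twice the number of
  letters, as \<open>sublist_count_le\<close> requires.\<close>

lemma word_energy_le:
  fixes z :: real
  assumes "finite A" "A \<subseteq> carrier G" "p \<le> u"
    and small: "\<And>R. \<lbrakk>set R \<subseteq> carrier G; length R \<le> 2 * u\<rbrakk>
           \<Longrightarrow> real (card (A \<inter> signed_span R (4 * p))) \<le> z"
  shows "real ((u choose p)\<^sup>2 * card A ^ (2 * (u - p)) * word_energy p A)
     \<le> (real (card A) + z) ^ (2 * u)"
proof -
  let ?I = "m_inv G ` A"
  let ?Bs = "replicate u A @ replicate u ?I"
  have inj: "inj_on (m_inv G) A"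
    using assms(2) by (metis inj_on_subset inv_inj)
  have small': "real (card (?I \<inter> signed_span R (4 * p))) \<le> z"
    if R: "set R \<subseteq> carrier G" "length R \<le> 2 * u" for R
  proof -
    have "?I \<inter> signed_span R (4 * p) \<subseteq> m_inv G ` (A \<inter> signed_span R (4 * p))"
    proof
      fix y assume y: "y \<in> ?I \<inter> signed_span R (4 * p)"
      then obtain a where a: "a \<in> A" "y = inv a" by auto
      then have "a \<in> signed_span R (4 * p)"
        using signed_span_inv[OF R(1), of y "4 * p"] y assms(2) by auto
      then show "y \<in> m_inv G ` (A \<inter> signed_span R (4 * p))" using a by auto
    qed
    then have "card (?I \<inter> signed_span R (4 * p)) \<le> card (A \<inter> signed_span R (4 * p))"
      using assms(1) by (intro surj_card_le) auto
    then show ?thesis using small[OF R] by linarith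
  qed
  have "real ((u choose p)\<^sup>2 * card A ^ (2 * (u - p)) * word_energy p A)
      \<le> real (\<Sum>w\<in>listset ?Bs. sublist_count w (2 * p) \<one>)"
    using word_energy_le_sublist_count[OF assms(1-3)] by (rule of_nat_mono)
  also have "\<dots> \<le> (\<Sum>w\<in>listset ?Bs. 2 ^ length (dependent_part (4 * p) w))"
    unfolding of_nat_sum
  proof (intro sum_mono)
    fix w assume "w \<in> listset ?Bs"
    then have "set w \<subseteq> carrier G"
      using set_listset[of w ?Bs] assms(2) by (fastforce split: if_splits)
    then have "sublist_count w (2 * p) \<one> \<le> 2 ^ length (dependent_part (4 * p) w)"
      by (intro sublist_count_le) auto
    then show "real (sublist_count w (2 * p) \<one>) \<le> 2 ^ length (dependent_part (4 * p) w)"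
      by (metis of_nat_le_iff of_nat_numeral of_nat_power)
  qed
  also have "\<dots> \<le> (real (card A) + z) ^ length ?Bs"
  proof (rule sum_dependent_le)
    show "\<And>B. B \<in> set ?Bs \<Longrightarrow> finite B \<and> card B = card A \<and> B \<subseteq> carrier G"
      using assms inj by (auto simp: card_image split: if_splits)
    fix B R assume B: "B \<in> set ?Bs" and R: "set R \<subseteq> carrier G" "length R \<le> length ?Bs"
    have "B = A \<or> B = ?I"
      using B by (auto split: if_splits)
    then show "real (card (B \<inter> signed_span R (4 * p))) \<le> z"
      using small[OF R(1)] small'[OF R(1)] R(2) by (auto simp: mult_2)
  qed
  finally show ?thesis by (simp add: mult_2)
qed

end

section \<open>Cauchy-Schwarz over fibres and log-convexity of the energies\<close>

lemma sum_Times: "(\<Sum>z\<in>P \<times> Q. F z) = (\<Sum>x\<in>P. \<Sum>y\<in>Q. F (x, y))"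
  by (simp add: sum.cartesian_product)

text \<open>The number of coincidences between \<open>f\<close> and \<open>h\<close> is the inner
  product of their fibre sizes, and the two factors on the right are the squared norms.\<close>

lemma fibre_Cauchy_Schwarz:
  fixes f :: "'b \<Rightarrow> 'd" and h :: "'c \<Rightarrow> 'd"
  assumes "finite P" "finite Q"
  shows "(\<Sum>x\<in>P. \<Sum>y\<in>Q. of_bool (f x = h y))\<^sup>2
    \<le> (\<Sum>x\<in>P. \<Sum>x'\<in>P. of_bool (f x = f x')) * (\<Sum>y\<in>Q. \<Sum>y'\<in>Q. of_bool (h y = h y') :: real)"
proof -
  define V where "V = f ` P \<union> h ` Q"
  define a where "a v = (\<Sum>x\<in>P. of_bool (f x = v) :: real)" for v
  define b where "b v = (\<Sum>y\<in>Q. of_bool (h y = v) :: real)" for v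
  have V: "finite V" using assms by (simp add: V_def)
  have of_bool_split: "of_bool (s = t) = (\<Sum>v\<in>V. of_bool (s = v) * of_bool (t = v) :: real)"
    if "s \<in> V" for s t
  proof -
    have "(\<Sum>v\<in>V. of_bool (s = v) * of_bool (t = v) :: real) = (\<Sum>v\<in>{s}. of_bool (s = v) * of_bool (t = v))"
      using V that by (intro sum.mono_neutral_right) auto
    then show ?thesis by auto
  qed
  \<comment> \<open>Sorting coincidences by their common value; used for the mixed count and for
    both squared norms.\<close>
  have gen: "(\<Sum>x\<in>U. \<Sum>y\<in>Y. of_bool (i x = j y))
      = (\<Sum>v\<in>V. (\<Sum>x\<in>U. of_bool (i x = v)) * (\<Sum>y\<in>Y. of_bool (j y = v) :: real))"
    if "i ` U \<subseteq> V" for U :: "'e set" and Y :: "'g set" and i j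
  proof -
    have "(\<Sum>x\<in>U. \<Sum>y\<in>Y. of_bool (i x = j y))
        = (\<Sum>x\<in>U. \<Sum>y\<in>Y. \<Sum>v\<in>V. of_bool (i x = v) * of_bool (j y = v) :: real)"
      using that by (intro sum.cong refl of_bool_split) auto
    also have "\<dots> = (\<Sum>x\<in>U. \<Sum>v\<in>V. \<Sum>y\<in>Y. of_bool (i x = v) * of_bool (j y = v))"
      by (intro sum.cong refl, subst sum.swap) (rule refl)
    also have "\<dots> = (\<Sum>v\<in>V. \<Sum>x\<in>U. \<Sum>y\<in>Y. of_bool (i x = v) * of_bool (j y = v))"
      by (rule sum.swap)
    finally show ?thesis by (simp add: sum_product)
  qed
  have "(\<Sum>v\<in>V. a v * b v)\<^sup>2 \<le> (\<Sum>v\<in>V. (a v)\<^sup>2) * (\<Sum>v\<in>V. (b v)\<^sup>2)"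
    by (rule Cauchy_Schwarz_ineq_sum)
  moreover have "(\<Sum>x\<in>P. \<Sum>y\<in>Q. of_bool (f x = h y)) = (\<Sum>v\<in>V. a v * b v)"
    unfolding a_def b_def by (rule gen) (auto simp: V_def)
  moreover have "(\<Sum>x\<in>P. \<Sum>x'\<in>P. of_bool (f x = f x')) = (\<Sum>v\<in>V. (a v)\<^sup>2)"
    unfolding a_def power2_eq_square by (rule gen) (auto simp: V_def)
  moreover have "(\<Sum>y\<in>Q. \<Sum>y'\<in>Q. of_bool (h y = h y')) = (\<Sum>v\<in>V. (b v)\<^sup>2)"
    unfolding b_def power2_eq_square by (rule gen) (auto simp: V_def)
  ultimately show ?thesis by simp
qed

text \<open>The ratios of consecutive terms increase. Hence the product \<open>a\<close> of the
  first \<open>k\<close> ratios is at most \<open>\<rho> k ^ k\<close>, the product of the next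
  \<open>j\<close> is at least \<open>\<rho> k ^ j\<close>, and comparing powers eliminates
  \<open>\<rho> k\<close>.\<close>

lemma log_convex_growth:
  fixes e :: "nat \<Rightarrow> real"
  assumes pos: "\<And>i. e i > 0" and conv: "\<And>i. (e (Suc i))\<^sup>2 \<le> e i * e (Suc (Suc i))"
  shows "e (Suc k) ^ (k + j) \<le> e (Suc (k + j)) ^ k * e 1 ^ j"
proof -
  define \<rho> where "\<rho> i = e (Suc i) / e i" for i
  have rho_pos: "\<rho> i > 0" for i
    using pos by (simp add: \<rho>_def)
  have "\<rho> i \<le> \<rho> (Suc i)" for i
    using conv[of i] pos[of i] pos[of "Suc i"] by (simp add: \<rho>_def field_simps power2_eq_square)
  then have rho_mono: "i \<le> j \<Longrightarrow> \<rho> i \<le> \<rho> j" for i j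
    by (rule lift_Suc_mono_le)
  have e: "e (Suc i) = e 1 * (\<Prod>l=1..i. \<rho> l)" for i
  proof (induction i)
    case (Suc i)
    have "e (Suc (Suc i)) = e (Suc i) * \<rho> (Suc i)"
      using pos[of "Suc i"] by (simp add: \<rho>_def)
    with Suc show ?case by simp
  qed simp
  define a where "a = (\<Prod>l=1..k. \<rho> l)"
  have a: "a > 0"
    unfolding a_def using rho_pos by (simp add: prod_pos)
  have "a \<le> \<rho> k ^ k"
    unfolding a_def using prod_mono[of "{1..k}" \<rho> "\<lambda>_. \<rho> k"] rho_mono rho_pos
    by (auto simp: less_imp_le)
  have "\<rho> k ^ j \<le> (\<Prod>l=Suc k..k + j. \<rho> l)"
    using prod_mono[of "{Suc k..k + j}" "\<lambda>_. \<rho> k" \<rho>] rho_mono rho_pos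
    by (auto simp: less_imp_le)
  have split: "(\<Prod>l=1..k + j. \<rho> l) = a * (\<Prod>l=Suc k..k + j. \<rho> l)"
    unfolding a_def using prod.ub_add_nat[of 1 k \<rho> j] by simp
  have "a ^ (k + j) = a ^ k * a ^ j"
    by (simp add: power_add)
  also have "\<dots> \<le> a ^ k * (\<rho> k ^ k) ^ j"
    using a \<open>a \<le> \<rho> k ^ k\<close> by (intro mult_left_mono power_mono) auto
  also have "\<dots> = a ^ k * (\<rho> k ^ j) ^ k"
    by (simp add: power_mult[symmetric] mult.commute)
  also have "\<dots> \<le> a ^ k * (\<Prod>l=Suc k..k + j. \<rho> l) ^ k"
    using a rho_pos \<open>\<rho> k ^ j \<le> _\<close> by (intro mult_left_mono power_mono) (auto simp: less_imp_le)
  also have "\<dots> = (\<Prod>l=1..k + j. \<rho> l) ^ k"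
    by (simp only: split power_mult_distrib)
  finally have *: "a ^ (k + j) \<le> (\<Prod>l=1..k + j. \<rho> l) ^ k" .
  have "e (Suc k) ^ (k + j) = e 1 ^ (k + j) * a ^ (k + j)"
    unfolding e[of k] a_def by (simp add: power_mult_distrib)
  also have "\<dots> \<le> e 1 ^ (k + j) * (\<Prod>l=1..k + j. \<rho> l) ^ k"
    using * pos[of 1] by (intro mult_left_mono) auto
  also have "\<dots> = e (Suc (k + j)) ^ k * e 1 ^ j"
    unfolding e[of "k + j"] by (simp add: power_mult_distrib power_add)
  finally show ?thesis .
qed

context comm_group
begin

lemma word_energy_1:
  assumes "A \<subseteq> carrier G" "finite A"
  shows "word_energy 1 A = card A"
proof -
  have "word_energy 1 A = (\<Sum>x\<in>A. \<Sum>y\<in>A. of_bool (x \<otimes> \<one> = y \<otimes> \<one>))"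
    unfolding word_energy_def One_nat_def replicate_Suc sum_listset_Cons by simp
  also have "\<dots> = (\<Sum>x\<in>A. \<Sum>y\<in>A. if x = y then 1 else 0)"
    using assms(1) by (intro sum.cong refl) (auto simp: subset_iff)
  finally show ?thesis using assms(2) by simp
qed

lemma word_energy_pos:
  assumes "finite A" "A \<noteq> {}"
  shows "word_energy k A > 0"
proof -
  obtain a where a: "a \<in> A" using assms by auto
  let ?w = "replicate k a"
  have w: "?w \<in> listset (replicate k A)" using a by (auto simp: listset_replicate)
  have fin: "finite (listset (replicate k A))" using assms by (intro finite_listset) auto
  have "(1::nat) \<le> (\<Sum>y\<in>listset (replicate k A). of_bool (word_prod ?w = word_prod y))"
    using member_le_sum[OF w, of "\<lambda>y. of_bool (word_prod ?w = word_prod y) :: nat"] fin by auto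
  also have "\<dots> \<le> word_energy k A"
    unfolding word_energy_def
    using member_le_sum[OF w, of "\<lambda>x. \<Sum>y\<in>listset (replicate k A). of_bool (word_prod x = word_prod y) :: nat"] fin
    by auto
  finally show ?thesis by simp
qed

text \<open>The fibres compared are those of \<open>word_prod\<close> on words of length \<open>k\<close> and those of
  \<open>(y, b) \<mapsto> word_prod y \<otimes> inv b\<close> on words of length \<open>k + 1\<close> with one extra letter.\<close>

lemma word_energy_log_convex:
  assumes "finite A" "A \<subseteq> carrier G"
  shows "(word_energy (Suc k) A)\<^sup>2 \<le> word_energy k A * word_energy (Suc (Suc k)) A"
proof -
  let ?L = "\<lambda>k. listset (replicate k A)"
  let ?h = "\<lambda>(y, b). word_prod y \<otimes> inv b"
  have fin: "finite (?L k)" for k using assms by (intro finite_listset) auto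
  have carr: "word_prod x \<in> carrier G" if "x \<in> ?L k" for x k
    using that assms(2) word_prod_closed[of x] by (auto simp: listset_replicate)
  \<comment> \<open>Moving \<open>b\<close> to the other side turns the mixed count into the energy
    of order \<open>k + 1\<close>.\<close>
  have "(\<Sum>x\<in>?L k. \<Sum>yb\<in>?L (Suc k) \<times> A. of_bool (word_prod x = ?h yb))
      = (\<Sum>x\<in>?L k. \<Sum>y\<in>?L (Suc k). \<Sum>b\<in>A. of_bool (word_prod x = word_prod y \<otimes> inv b) :: real)"
    by (simp add: sum.cartesian_product case_prod_unfold)
  also have "\<dots> = (\<Sum>x\<in>?L k. \<Sum>b\<in>A. \<Sum>y\<in>?L (Suc k). of_bool (word_prod x = word_prod y \<otimes> inv b))"
    by (intro sum.cong refl sum.swap)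
  also have "\<dots> = (\<Sum>b\<in>A. \<Sum>x\<in>?L k. \<Sum>y\<in>?L (Suc k). of_bool (word_prod (b # x) = word_prod y))"
  proof (subst sum.swap, intro sum.cong refl arg_cong[where f = of_bool])
    fix b x y assume "b \<in> A" "x \<in> ?L k" "y \<in> ?L (Suc k)"
    then have "word_prod x \<in> carrier G" "word_prod y \<in> carrier G" "b \<in> carrier G"
      using carr[of x k] carr[of y "Suc k"] assms(2) by auto
    then show "word_prod x = word_prod y \<otimes> inv b \<longleftrightarrow> word_prod (b # x) = word_prod y"
      by (simp only: inv_solve_right foldr.simps o_apply m_comm[of b] eq_commute)
  qed
  also have "\<dots> = (\<Sum>x\<in>?L (Suc k). \<Sum>y\<in>?L (Suc k). of_bool (word_prod x = word_prod y))"
    unfolding replicate_Suc[of k] sum_listset_Cons[where Bs = "replicate k A"] by (rule refl)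
  also have "\<dots> = real (word_energy (Suc k) A)"
    by (simp add: word_energy_def)
  finally have 1: "(\<Sum>x\<in>?L k. \<Sum>yb\<in>?L (Suc k) \<times> A. of_bool (word_prod x = ?h yb))
    = real (word_energy (Suc k) A)" .
  \<comment> \<open>Clearing inverses attaches \<open>b'\<close> to \<open>y\<close> and
    \<open>b\<close> to \<open>y'\<close>. The sums are then reordered so that each letter stands
    next to the word it extends.\<close>
  have "(\<Sum>yb\<in>?L (Suc k) \<times> A. \<Sum>yb'\<in>?L (Suc k) \<times> A. of_bool (?h yb = ?h yb'))
      = (\<Sum>y\<in>?L (Suc k). \<Sum>b\<in>A. \<Sum>y'\<in>?L (Suc k). \<Sum>b'\<in>A.
          of_bool (word_prod y \<otimes> inv b = word_prod y' \<otimes> inv b') :: real)"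
    by (simp only: sum_Times prod.case)
  also have "\<dots> = (\<Sum>y\<in>?L (Suc k). \<Sum>b\<in>A. \<Sum>y'\<in>?L (Suc k). \<Sum>b'\<in>A.
          of_bool (word_prod (b' # y) = word_prod (b # y')))"
  proof (intro sum.cong refl arg_cong[where f = of_bool])
    fix y b y' b' assume *: "y \<in> ?L (Suc k)" "b \<in> A" "y' \<in> ?L (Suc k)" "b' \<in> A"
    have c: "word_prod y \<in> carrier G" "word_prod y' \<in> carrier G" "b \<in> carrier G" "b' \<in> carrier G"
      using * assms(2) carr[of y "Suc k"] carr[of y' "Suc k"] by auto
    have "word_prod y \<otimes> inv b = word_prod y' \<otimes> inv b'
        \<longleftrightarrow> word_prod y = word_prod y' \<otimes> inv b' \<otimes> b"
      using c by (metis inv_solve_right' m_closed inv_closed)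
    also have "word_prod y' \<otimes> inv b' \<otimes> b = (word_prod y' \<otimes> b) \<otimes> inv b'"
      using c by (simp add: m_ac)
    also have "word_prod y = \<dots> \<longleftrightarrow> word_prod (b' # y) = word_prod (b # y')"
      using c by (simp only: inv_solve_right m_closed foldr.simps o_apply
          m_comm[of b] m_comm[of b'] eq_commute)
    finally show "word_prod y \<otimes> inv b = word_prod y' \<otimes> inv b'
        \<longleftrightarrow> word_prod (b' # y) = word_prod (b # y')" .
  qed
  also have "\<dots> = (\<Sum>y\<in>?L (Suc k). \<Sum>b\<in>A. \<Sum>b'\<in>A. \<Sum>y'\<in>?L (Suc k).
          of_bool (word_prod (b' # y) = word_prod (b # y')))"
    by (intro sum.cong refl sum.swap)
  also have "\<dots> = (\<Sum>y\<in>?L (Suc k). \<Sum>b'\<in>A. \<Sum>b\<in>A. \<Sum>y'\<in>?L (Suc k).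
          of_bool (word_prod (b' # y) = word_prod (b # y')))"
    by (intro sum.cong refl sum.swap)
  also have "\<dots> = (\<Sum>b'\<in>A. \<Sum>y\<in>?L (Suc k). \<Sum>b\<in>A. \<Sum>y'\<in>?L (Suc k).
          of_bool (word_prod (b' # y) = word_prod (b # y')))"
    by (rule sum.swap)
  also have "\<dots> = (\<Sum>x\<in>?L (Suc (Suc k)). \<Sum>y\<in>?L (Suc (Suc k)). of_bool (word_prod x = word_prod y))"
    unfolding replicate_Suc[of "Suc k"] sum_listset_Cons[where Bs = "replicate (Suc k) A"] by (rule refl)
  also have "\<dots> = real (word_energy (Suc (Suc k)) A)"
    by (simp add: word_energy_def)
  finally have 2: "(\<Sum>yb\<in>?L (Suc k) \<times> A. \<Sum>yb'\<in>?L (Suc k) \<times> A. of_bool (?h yb = ?h yb'))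
      = real (word_energy (Suc (Suc k)) A)" .
  have "(real (word_energy (Suc k) A))\<^sup>2 \<le> real (word_energy k A) * real (word_energy (Suc (Suc k)) A)"
    using fibre_Cauchy_Schwarz[of "?L k" "?L (Suc k) \<times> A" word_prod ?h,
        OF fin finite_cartesian_product[OF fin assms(1)]]
    unfolding 1 2 by (simp only: word_energy_def of_nat_sum of_nat_of_bool)
  then show ?thesis
    by (metis of_nat_le_iff of_nat_mult of_nat_power)
qed

text \<open>Log-convexity interpolates \<open>k\<close> between 1 and \<open>p\<close>, since
  \<open>k * (p - 1) = p * (k - 1) + (p - k)\<close>; the energy of order 1 is
  \<open>card A\<close>.\<close>

lemma word_energy_growth:
  assumes "finite A" "A \<subseteq> carrier G" "A \<noteq> {}" "k \<ge> 1" "k \<le> p"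
  shows "word_energy k A ^ (p - 1) \<le> word_energy p A ^ (k - 1) * card A ^ (p - k)"
proof -
  have "real (word_energy (Suc (k - 1)) A) ^ ((k - 1) + (p - k))
      \<le> real (word_energy (Suc ((k - 1) + (p - k))) A) ^ (k - 1) * real (word_energy 1 A) ^ (p - k)"
  proof (rule log_convex_growth)
    show "0 < real (word_energy i A)" for i
      using word_energy_pos[OF assms(1,3)] by simp
    show "(real (word_energy (Suc i) A))\<^sup>2 \<le> real (word_energy i A) * real (word_energy (Suc (Suc i)) A)" for i
      using word_energy_log_convex[OF assms(1,2), of i]
      by (metis of_nat_le_iff of_nat_mult of_nat_power)
  qed
  moreover have "Suc (k - 1) = k" "(k - 1) + (p - k) = p - 1" "Suc (p - 1) = p"
    using assms by auto
  ultimately have "real (word_energy k A ^ (p - 1)) \<le> real (word_energy p A ^ (k - 1) * card A ^ (p - k))"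
    using word_energy_1[OF assms(2,1)] by simp
  then show ?thesis
    by (rule of_nat_le_iff[THEN iffD1])
qed

section \<open>Agreement of word energy with \<open>T_energy\<close>\<close>

text \<open>The function \<open>F\<close> is arbitrary for two reasons: the induction replaces it by
  its translate by the last value \<open>y\<close>, and the energy needs the lemma once for each of
  its two tuples.\<close>

lemma sum_PiE_finprod:
  fixes F :: "'a \<Rightarrow> 'c :: comm_monoid_add"
  assumes "A \<subseteq> carrier G" "finite A"
  shows "(\<Sum>a\<in>{1..k} \<rightarrow>\<^sub>E A. F (finprod G a {1..k})) = (\<Sum>x\<in>listset (replicate k A). F (word_prod x))"
proof (induction k arbitrary: F)
  case 0
  then show ?case by simp
next
  case (Suc k)
  let ?f = "\<lambda>(y, g). g(Suc k := y)"
  have ins: "{1..Suc k} = insert (Suc k) {1..k}" by auto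
  have "(\<Sum>a\<in>{1..Suc k} \<rightarrow>\<^sub>E A. F (finprod G a {1..Suc k}))
      = (\<Sum>yg\<in>A \<times> ({1..k} \<rightarrow>\<^sub>E A). F (finprod G (?f yg) {1..Suc k}))"
    unfolding ins PiE_insert_eq
    by (subst sum.reindex) (auto intro!: inj_combinator simp: o_def)
  also have "\<dots> = (\<Sum>yg\<in>A \<times> ({1..k} \<rightarrow>\<^sub>E A). F (fst yg \<otimes> finprod G (snd yg) {1..k}))"
  proof (intro sum.cong refl arg_cong[where f = F])
    fix yg assume "yg \<in> A \<times> ({1..k} \<rightarrow>\<^sub>E A)"
    then obtain y g where yg: "yg = (y, g)" "y \<in> carrier G" "g \<in> {1..k} \<rightarrow> carrier G"
      using assms(1) by (auto simp: PiE_def Pi_def)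
    have "finprod G (g(Suc k := y)) {1..k} = finprod G g {1..k}"
      using yg by (intro finprod_cong') auto
    then show "finprod G (?f yg) {1..Suc k} = fst yg \<otimes> finprod G (snd yg) {1..k}"
      using yg unfolding ins by (subst finprod_insert) (auto simp: Pi_def)
  qed
  also have "\<dots> = (\<Sum>y\<in>A. \<Sum>g\<in>{1..k} \<rightarrow>\<^sub>E A. F (y \<otimes> finprod G g {1..k}))"
    by (simp add: sum.cartesian_product case_prod_unfold)
  also have "\<dots> = (\<Sum>y\<in>A. \<Sum>x\<in>listset (replicate k A). F (y \<otimes> word_prod x))"
    by (intro sum.cong refl Suc.IH)
  also have "\<dots> = (\<Sum>x\<in>listset (replicate (Suc k) A). F (word_prod x))"
    unfolding replicate_Suc sum_listset_Cons by simp
  finally show ?case .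
qed

lemma T_energy_eq_word_energy:
  assumes "A \<subseteq> carrier G" "finite A"
  shows "T_energy G k A = word_energy k A"
proof -
  let ?P = "{1..k} \<rightarrow>\<^sub>E A"
  have fin: "finite ?P" using assms by (intro finite_PiE) auto
  have "{(a, a'). a \<in> ?P \<and> a' \<in> ?P \<and> finprod G a {1..k} = finprod G a' {1..k}}
      = {z \<in> ?P \<times> ?P. finprod G (fst z) {1..k} = finprod G (snd z) {1..k}}"
    by auto
  then have "T_energy G k A
      = (\<Sum>z\<in>?P \<times> ?P. of_bool (finprod G (fst z) {1..k} = finprod G (snd z) {1..k}))"
    unfolding T_energy_def using fin by (simp add: sum.If_cases of_bool_def Collect_conj_eq)
  also have "\<dots> = (\<Sum>a\<in>?P. \<Sum>a'\<in>?P. of_bool (finprod G a {1..k} = finprod G a' {1..k}))"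
    by (simp add: sum.cartesian_product case_prod_unfold)
  also have "\<dots> = (\<Sum>x\<in>listset (replicate k A). \<Sum>a'\<in>?P. of_bool (word_prod x = finprod G a' {1..k}))"
    by (rule sum_PiE_finprod[OF assms])
  also have "\<dots> = word_energy k A"
    unfolding word_energy_def by (intro sum.cong refl sum_PiE_finprod[OF assms])
  finally show ?thesis .
qed

section \<open>Dimension of a signed span\<close>

text \<open>Products of powers of the entries whose exponents have absolute values summing to at
  most \<open>M\<close>, an l1 ball of exponents. Unlike signed spans, such sets absorb products by
  adding radii.\<close>

primrec box :: "'a list \<Rightarrow> nat \<Rightarrow> 'a set" where
  "box [] M = {\<one>}"
| "box (x # xs) M = (\<Union>j\<in>{- int M..int M}. (\<lambda>h. x [^] j \<otimes> h) ` box xs (M - nat \<bar>j\<bar>))"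

lemma mem_box_Cons:
  "g \<in> box (x # xs) M \<longleftrightarrow> (\<exists>j h. \<bar>j\<bar> \<le> int M \<and> h \<in> box xs (M - nat \<bar>j\<bar>) \<and> g = x [^] j \<otimes> h)"
  by (auto simp: image_iff Bex_def abs_le_iff minus_le_iff)

lemma box_closed: "set xs \<subseteq> carrier G \<Longrightarrow> box xs M \<subseteq> carrier G"
  by (induction xs arbitrary: M) fastforce+

lemma box_mono: "M \<le> M' \<Longrightarrow> box xs M \<subseteq> box xs M'"
proof (induction xs arbitrary: M M')
  case (Cons x xs)
  show ?case
  proof
    fix g assume "g \<in> box (x # xs) M"
    then obtain j h where j: "\<bar>j\<bar> \<le> int M" "h \<in> box xs (M - nat \<bar>j\<bar>)" "g = x [^] j \<otimes> h"
      unfolding mem_box_Cons by auto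
    have "h \<in> box xs (M' - nat \<bar>j\<bar>)"
      using Cons.IH[OF diff_le_mono[OF Cons.prems]] j by blast
    moreover have "\<bar>j\<bar> \<le> int M'" using j Cons.prems by auto
    ultimately show "g \<in> box (x # xs) M'" unfolding mem_box_Cons using j(3) by auto
  qed
qed simp

lemma box_mult:
  assumes "set xs \<subseteq> carrier G" "g \<in> box xs M" "g' \<in> box xs M'"
  shows "g \<otimes> g' \<in> box xs (M + M')"
  using assms
proof (induction xs arbitrary: M M' g g')
  case (Cons x xs)
  obtain j h where j: "\<bar>j\<bar> \<le> int M" "h \<in> box xs (M - nat \<bar>j\<bar>)" "g = x [^] j \<otimes> h"
    using Cons.prems unfolding mem_box_Cons by auto
  obtain j' h' where j': "\<bar>j'\<bar> \<le> int M'" "h' \<in> box xs (M' - nat \<bar>j'\<bar>)" "g' = x [^] j' \<otimes> h'"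
    using Cons.prems unfolding mem_box_Cons by auto
  have x: "x \<in> carrier G" "set xs \<subseteq> carrier G" using Cons.prems by auto
  have h: "h \<in> carrier G" "h' \<in> carrier G" using j j' box_closed[OF x(2)] by auto
  have "h \<otimes> h' \<in> box xs ((M - nat \<bar>j\<bar>) + (M' - nat \<bar>j'\<bar>))"
    by (rule Cons.IH[OF x(2) j(2) j'(2)])
  moreover have "(M - nat \<bar>j\<bar>) + (M' - nat \<bar>j'\<bar>) \<le> M + M' - nat \<bar>j + j'\<bar>"
  proof -
    have "nat \<bar>j\<bar> \<le> M" "nat \<bar>j'\<bar> \<le> M'"
      using j(1) j'(1) by (simp_all add: nat_le_iff)
    moreover have "nat \<bar>j + j'\<bar> \<le> nat \<bar>j\<bar> + nat \<bar>j'\<bar>"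
      by (metis abs_ge_zero abs_triangle_ineq nat_add_distrib nat_mono)
    moreover have "(M - a) + (M' - b) \<le> M + M' - c" if "a \<le> M" "b \<le> M'" "c \<le> a + b" for a b c
      using that by linarith
    ultimately show ?thesis by blast
  qed
  ultimately have "h \<otimes> h' \<in> box xs (M + M' - nat \<bar>j + j'\<bar>)"
    using box_mono by blast
  moreover have "g \<otimes> g' = x [^] (j + j') \<otimes> (h \<otimes> h')"
    using x h j(3) j'(3) by (simp add: int_pow_mult m_ac)
  moreover have "\<bar>j + j'\<bar> \<le> int (M + M')" using j j' by auto
  ultimately show ?case unfolding mem_box_Cons by blast
qed simp

lemma one_in_box: "\<one> \<in> box xs M"
proof (induction xs arbitrary: M)
  case (Cons x xs)
  have "\<one> = x [^] (0 :: int) \<otimes> \<one>" by simp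
  then show ?case using Cons[of M] unfolding mem_box_Cons
    by (intro exI[of _ "0 :: int"] exI[of _ \<one>]) auto
qed simp

lemma signed_span_subset_box:
  assumes "set xs \<subseteq> carrier G"
  shows "signed_span xs s \<subseteq> box xs s"
  using assms
proof (induction xs arbitrary: s)
  case (Cons y ys)
  have y: "y \<in> carrier G" and ys: "set ys \<subseteq> carrier G" using Cons.prems by auto
  have IH: "signed_span ys t \<subseteq> box ys t" for t using Cons ys by simp
  note cl = signed_span_closed[OF ys]
  show ?case
  proof
    fix g assume g: "g \<in> signed_span (y # ys) s"
    obtain j h where "\<bar>j\<bar> \<le> int s" "h \<in> signed_span ys (s - nat \<bar>j\<bar>)" "g = y [^] j \<otimes> h"
    proof (cases "g \<in> signed_span ys s")
      case True
      then show ?thesis using that[of 0 g] cl by (auto simp: subset_iff)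
    next
      case False
      then obtain t h where t: "s = Suc t" "h \<in> signed_span ys t" "g = h \<otimes> y \<or> g = h \<otimes> inv y"
        using g by (auto split: nat.splits)
      then show ?thesis
        using that[of 1 h] that[of "-1" h] cl y by (auto simp: m_comm int_pow_neg subset_iff)
    qed
    then show "g \<in> box (y # ys) s" unfolding mem_box_Cons using IH by blast
  qed
qed simp

lemma finite_box: "finite (box xs M)"
  by (induction xs arbitrary: M) auto

text \<open>Weighting an exponent vector by \<open>y\<close> to its l1 norm costs at most a factor
  \<open>(1 / y) ^ M\<close>, after which the count factorises into geometric series. The parameter
  \<open>y\<close> is left free for later tuning.\<close>

lemma card_box_le:
  fixes y :: real
  assumes "0 < y" "y < 1"
  shows "real (card (box xs M)) \<le> (1 / y) ^ M * (2 / (1 - y)) ^ length xs"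
proof (induction xs arbitrary: M)
  case Nil
  then show ?case using assms by (simp add: one_le_power)
next
  case (Cons x xs)
  let ?C = "(2 / (1 - y)) ^ length xs"
  have C: "?C \<ge> 0" using assms by simp
  have "real (card (box (x # xs) M)) \<le> real (\<Sum>j\<in>{- int M..int M}. card ((\<lambda>h. x [^] j \<otimes> h) ` box xs (M - nat \<bar>j\<bar>)))"
    unfolding box.simps of_nat_le_iff by (rule card_UN_le) simp
  also have "\<dots> \<le> (\<Sum>j\<in>{- int M..int M}. real (card (box xs (M - nat \<bar>j\<bar>))))"
    unfolding of_nat_sum by (intro sum_mono of_nat_mono card_image_le finite_box)
  also have "\<dots> \<le> (\<Sum>j\<in>{- int M..int M}. (1 / y) ^ M * ?C * y ^ nat \<bar>j\<bar>)"
  proof (intro sum_mono)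
    fix j assume j: "j \<in> {- int M..int M}"
    have "(1 / y) ^ (M - nat \<bar>j\<bar>) = (1 / y) ^ M * y ^ nat \<bar>j\<bar>"
    proof -
      have "y ^ M = y ^ nat \<bar>j\<bar> * y ^ (M - nat \<bar>j\<bar>)"
        using j by (auto simp: power_add[symmetric])
      then show ?thesis using assms by (simp add: power_one_over field_simps)
    qed
    then show "real (card (box xs (M - nat \<bar>j\<bar>))) \<le> (1 / y) ^ M * ?C * y ^ nat \<bar>j\<bar>"
      using Cons[of "M - nat \<bar>j\<bar>"] by (simp add: mult_ac)
  qed
  also have "\<dots> = (1 / y) ^ M * ?C * (\<Sum>j\<in>{- int M..int M}. y ^ nat \<bar>j\<bar>)"
    by (simp add: sum_distrib_left)
  also have "(\<Sum>j\<in>{- int M..int M}. y ^ nat \<bar>j\<bar>) \<le> 2 / (1 - y)"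
  proof -
    \<comment> \<open>The exponent 0 is covered twice, which gives the simple bound
      \<open>2 / (1 - y)\<close>.\<close>
    have "{- int M..int M} \<subseteq> int ` {..M} \<union> (\<lambda>i. - int i) ` {..M}"
    proof
      fix j assume "j \<in> {- int M..int M}"
      then have "(j = int (nat \<bar>j\<bar>) \<or> j = - int (nat \<bar>j\<bar>)) \<and> nat \<bar>j\<bar> \<le> M" by auto
      then show "j \<in> int ` {..M} \<union> (\<lambda>i. - int i) ` {..M}" by blast
    qed
    then have "(\<Sum>j\<in>{- int M..int M}. y ^ nat \<bar>j\<bar>)
        \<le> (\<Sum>j\<in>int ` {..M} \<union> (\<lambda>i. - int i) ` {..M}. y ^ nat \<bar>j\<bar>)"
      using assms by (intro sum_mono2) auto
    also have "\<dots> \<le> (\<Sum>j\<in>int ` {..M}. y ^ nat \<bar>j\<bar>) + (\<Sum>j\<in>(\<lambda>i. - int i) ` {..M}. y ^ nat \<bar>j\<bar>)"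
      using assms by (subst sum_Un) (auto intro!: sum_nonneg)
    also have "\<dots> = 2 * (\<Sum>i\<le>M. y ^ i)"
      by (subst (1 2) sum.reindex) (auto simp: inj_on_def o_def)
    also have "(\<Sum>i\<le>M. y ^ i) \<le> 1 / (1 - y)"
      using assms sum_gp0[of y M] by (simp add: divide_right_mono)
    finally show ?thesis by simp
  qed
  finally show ?case
    using assms C by (simp add: mult_left_mono mult_ac)
qed

text \<open>The difference of two indicator functions takes values in {-1, 0, 1}, so two subsets
  with equal products yield a relation that dissociativity forces to be trivial.\<close>

lemma dissociated_subset_prod_inj:
  assumes "dissociated G D"
  shows "inj_on (\<lambda>U. finprod G (\<lambda>x. x) U) (Pow D)"
proof (rule inj_onI)
  fix U W assume UW: "U \<in> Pow D" "W \<in> Pow D" and eq: "finprod G (\<lambda>x. x) U = finprod G (\<lambda>x. x) W"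
  have D: "finite D" "D \<subseteq> carrier G" using assms by (auto simp: dissociated_def)
  have prod: "finprod G (\<lambda>x. x [^] (of_bool (x \<in> Z) :: int)) D = finprod G (\<lambda>x. x) Z" if "Z \<subseteq> D" for Z
    using that D by (intro finprod_mono_neutral_cong_right) (auto simp: Pi_def subset_iff)
  define \<epsilon> :: "'a \<Rightarrow> int" where "\<epsilon> x = of_bool (x \<in> U) - of_bool (x \<in> W)" for x
  have Xc: "finprod G (\<lambda>x. x) U \<in> carrier G" "finprod G (\<lambda>x. x) W \<in> carrier G"
    using UW D by (auto intro!: finprod_closed)
  have "finprod G (\<lambda>x. x [^] (of_bool (x \<in> U) :: int)) D
      = finprod G (\<lambda>x. x [^] \<epsilon> x \<otimes> x [^] (of_bool (x \<in> W) :: int)) D"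
    using D by (intro finprod_cong') (auto simp: \<epsilon>_def int_pow_mult[symmetric] Pi_def subset_iff simp del: of_bool_eq_iff)
  also have "\<dots> = finprod G (\<lambda>x. x [^] \<epsilon> x) D \<otimes> finprod G (\<lambda>x. x [^] (of_bool (x \<in> W) :: int)) D"
    using D by (intro finprod_multf) auto
  finally have "finprod G (\<lambda>x. x) U = finprod G (\<lambda>x. x [^] \<epsilon> x) D \<otimes> finprod G (\<lambda>x. x) U"
    using UW eq by (simp add: prod)
  moreover have "finprod G (\<lambda>x. x [^] \<epsilon> x) D \<in> carrier G"
    using D by (intro finprod_closed) auto
  ultimately have "finprod G (\<lambda>x. x [^] \<epsilon> x) D = \<one>"
    using Xc by (metis r_cancel_one')
  moreover have "\<forall>x\<in>D. \<epsilon> x \<in> {-1, 0, 1}" by (auto simp: \<epsilon>_def)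
  ultimately have "\<forall>x\<in>D. \<epsilon> x = 0"
    using assms by (auto simp: dissociated_def)
  then show "U = W"
    using UW by (auto simp: \<epsilon>_def of_bool_def split: if_splits)
qed

lemma finprod_in_box:
  assumes "set xs \<subseteq> carrier G" "finite U" "U \<subseteq> box xs s"
  shows "finprod G (\<lambda>x. x) U \<in> box xs (s * card U)"
  using assms(2,3)
proof (induction U rule: finite_induct)
  case empty
  then show ?case by (simp add: one_in_box)
next
  case (insert a U)
  have "U \<subseteq> carrier G" "a \<in> carrier G" using insert box_closed[OF assms(1)] by auto
  then have "finprod G (\<lambda>x. x) (insert a U) = a \<otimes> finprod G (\<lambda>x. x) U"
    using insert by (intro finprod_insert) auto
  then show ?case
    using box_mult[OF assms(1), of a s "finprod G (\<lambda>x. x) U" "s * card U"] insert by simp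
qed

lemma card_dissociated_le:
  assumes xs: "set xs \<subseteq> carrier G" and D: "dissociated G D" "D \<subseteq> signed_span xs q" and q: "q \<ge> 1"
  shows "real (card D) \<le> 2 * real (length xs) * log 2 (8 * real q)"
proof -
  \<comment> \<open>With this choice \<open>(1 / y) ^ (q * card D)\<close> is 2 to the power
    \<open>card D / 2\<close>, so half of the exponent on the left survives the comparison.\<close>
  define y where "y = 2 powr (- 1 / (2 * real q))"
  have fin: "finite D" using D by (simp add: dissociated_def)
  have y: "0 < y" "y < 1" using q by (auto simp: y_def powr_less_one)
  have sub: "(\<lambda>U. finprod G (\<lambda>x. x) U) ` Pow D \<subseteq> box xs (q * card D)"
  proof (intro image_subsetI)
    fix U assume X: "U \<in> Pow D"
    then have "finite U" "U \<subseteq> box xs q" "card U \<le> card D"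
      using fin D signed_span_subset_box[OF xs, of q] by (auto intro: finite_subset card_mono)
    then show "finprod G (\<lambda>x. x) U \<in> box xs (q * card D)"
      using finprod_in_box[OF xs, of U q] box_mono[of "q * card U" "q * card D" xs] by auto
  qed
  have "2 ^ card D = card ((\<lambda>U. finprod G (\<lambda>x. x) U) ` Pow D)"
    using dissociated_subset_prod_inj[OF D(1)] fin by (simp add: card_image card_Pow)
  also have "\<dots> \<le> card (box xs (q * card D))"
    using sub finite_box by (intro card_mono)
  finally have "real (2 ^ card D) \<le> real (card (box xs (q * card D)))"
    by (rule of_nat_mono)
  also have "\<dots> \<le> (1 / y) ^ (q * card D) * (2 / (1 - y)) ^ length xs"
    by (rule card_box_le[OF y])
  finally have le: "2 ^ card D \<le> (1 / y) ^ (q * card D) * (2 / (1 - y)) ^ length xs"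
    by simp
  have "(1 / y) ^ q = 2 powr (1 / 2)"
    using q by (simp add: y_def powr_minus_divide[symmetric] powr_power)
  then have ypow: "(1 / y) ^ (q * card D) = 2 powr (real (card D) / 2)"
    by (simp add: power_mult powr_power)
  have "y ^ (2 * q) = 1 / 2"
  proof -
    have "y ^ (2 * q) = 2 powr (- 1 / (2 * real q) * real (2 * q))"
      unfolding y_def by (subst powr_power) (auto simp: mult.commute)
    also have "- 1 / (2 * real q) * real (2 * q) = - 1"
      using q by simp
    finally show ?thesis by (simp add: powr_minus_divide)
  qed
  \<comment> \<open>Bernoulli's inequality gives \<open>1 - y \<ge> 1 / (4 * q)\<close>, hence at
    most \<open>8 * q\<close> per entry of \<open>xs\<close>.\<close>
  also have "\<dots> \<le> (1 - 1 / (4 * real q)) ^ (2 * q)"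
    using Bernoulli_inequality[of "- 1 / (4 * real q)" "2 * q"] q by simp
  finally have "y \<le> 1 - 1 / (4 * real q)"
    using q by (subst (asm) power_mono_iff) (auto simp: y less_imp_le field_simps)
  then have y_le: "1 / (4 * real q) \<le> 1 - y" by simp
  then have "2 / (1 - y) \<le> 2 / (1 / (4 * real q))"
    using q y by (intro divide_left_mono) auto
  then have "(2 / (1 - y)) ^ length xs \<le> (8 * real q) ^ length xs"
    using y q by (intro power_mono) auto
  then have "2 ^ card D \<le> 2 powr (real (card D) / 2) * (8 * real q) ^ length xs"
    using le unfolding ypow by (smt (verit) mult_left_mono powr_ge_zero)
  then have "log 2 (2 ^ card D) \<le> log 2 (2 powr (real (card D) / 2) * (8 * real q) ^ length xs)"
    using q by (subst log_le_cancel_iff) auto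
  also have "\<dots> = real (card D) / 2 + real (length xs) * log 2 (8 * real q)"
    using q by (simp add: log_mult log_nat_power distrib_left)
  finally show ?thesis by (simp add: log_nat_power)
qed

lemma add_dim_signed_span_le:
  assumes "set xs \<subseteq> carrier G" "finite B" "B \<subseteq> signed_span xs q" "q \<ge> 1"
  shows "real (add_dim G B) \<le> 2 * real (length xs) * log 2 (8 * real q)"
proof -
  let ?S = "card ` {D. D \<subseteq> B \<and> dissociated G D}"
  have "finite ?S" using assms(2) by (auto intro: finite_subset[of _ "Pow B"])
  moreover have "dissociated G {}" by (simp add: dissociated_def)
  then have "?S \<noteq> {}" by blast
  ultimately have "add_dim G B \<in> ?S" unfolding add_dim_def by (rule Max_in)
  then obtain D where "D \<subseteq> B" "dissociated G D" "add_dim G B = card D" by auto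
  then show ?thesis using card_dissociated_le[OF assms(1), of D q] assms by auto
qed

end

section \<open>The bounds in a fixed group\<close>

context comm_group
begin

text \<open>In an equality of two products all letters but one determine the last. This later yields
  \<open>c \<le> 1\<close>.\<close>

lemma word_energy_Suc_le:
  assumes A: "finite A" "A \<subseteq> carrier G"
  shows "word_energy (Suc j) A \<le> card A ^ (2 * j + 1)"
proof -
  let ?L = "\<lambda>j. listset (replicate j A)"
  have split: "sum F (?L (Suc j)) = (\<Sum>b\<in>A. \<Sum>x\<in>?L j. F (b # x))" for F :: "'a list \<Rightarrow> nat"
    by (simp only: replicate_Suc sum_listset_Cons)
  have "word_energy (Suc j) A
      = (\<Sum>b\<in>A. \<Sum>x\<in>?L j. \<Sum>y\<in>?L (Suc j). of_bool (word_prod (b # x) = word_prod y))"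
    unfolding word_energy_def by (rule split)
  also have "\<dots> = (\<Sum>x\<in>?L j. \<Sum>b\<in>A. \<Sum>y\<in>?L (Suc j). of_bool (word_prod (b # x) = word_prod y))"
    by (rule sum.swap)
  also have "\<dots> = (\<Sum>x\<in>?L j. \<Sum>y\<in>?L (Suc j). \<Sum>b\<in>A. of_bool (word_prod (b # x) = word_prod y))"
    by (intro sum.cong refl sum.swap)
  also have "\<dots> \<le> (\<Sum>x\<in>?L j. \<Sum>y\<in>?L (Suc j). 1)"
  proof (intro sum_mono)
    fix x y assume "x \<in> ?L j" "y \<in> ?L (Suc j)"
    then have c: "word_prod x \<in> carrier G" "word_prod y \<in> carrier G"
      using A(2) word_prod_closed[of x] word_prod_closed[of y] unfolding listset_replicate by auto
    have "(\<Sum>b\<in>A. of_bool (word_prod (b # x) = word_prod y))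
        \<le> (\<Sum>b\<in>A. if b = word_prod y \<otimes> inv (word_prod x) then 1 else 0 :: nat)"
    proof (intro sum_mono)
      fix b assume "b \<in> A"
      then have "b \<in> carrier G" using A(2) by auto
      then show "of_bool (word_prod (b # x) = word_prod y)
          \<le> (if b = word_prod y \<otimes> inv (word_prod x) then 1 else 0 :: nat)"
        using inv_solve_right[of b "word_prod y" "word_prod x"] c by auto
    qed
    also have "\<dots> \<le> 1" using A(1) by simp
    finally show "(\<Sum>b\<in>A. of_bool (word_prod (b # x) = word_prod y)) \<le> (1 :: nat)" .
  qed
  also have "\<dots> = card A ^ (2 * j + 1)"
    using card_listset_replicate[OF A(1)]
    by (simp del: replicate_Suc listset.simps add: mult_2 power_add)
  finally show ?thesis .
qed

text \<open>If every intersection were smaller, \<open>word_energy_le\<close> with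
  \<open>u = p * t\<close> would bound the energy from above and contradict
  \<open>energy\<close>.\<close>

lemma large_span_intersection:
  fixes t p :: nat
  assumes A: "finite A" "A \<subseteq> carrier G" "A \<noteq> {}" and t: "t \<ge> 1" and p: "p \<ge> 1"
    and energy: "3 * real (card A) ^ (2 * p) < real t ^ (2 * p) * real (word_energy p A)"
  shows "\<exists>R. set R \<subseteq> carrier G \<and> length R \<le> 2 * (p * t) \<and>
    real (card A) / (2 * real p * real t) \<le> real (card (A \<inter> signed_span R (4 * p)))"
proof (rule ccontr)
  let ?n = "real (card A)" and ?u = "p * t"
  let ?z = "?n / (2 * real p * real t)"
  assume "\<not> ?thesis"
  then have "real (card (A \<inter> signed_span R (4 * p))) \<le> ?z"
    if "set R \<subseteq> carrier G" "length R \<le> 2 * ?u" for R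
    using that by force
  then have le: "real ((?u choose p)\<^sup>2 * card A ^ (2 * (?u - p)) * word_energy p A) \<le> (?n + ?z) ^ (2 * ?u)"
    using A t by (intro word_energy_le) auto
  have n: "?n > 0" using A by (simp add: card_gt_0_iff)
  \<comment> \<open>The choice \<open>u = p * t\<close> makes \<open>u / p\<close> equal to
    \<open>t\<close>.\<close>
  have "real t ^ p \<le> real (?u choose p)"
    using binomial_ge_n_over_k_pow_k[of p ?u, where 'a = real] t p by simp
  then have "(real t ^ p)\<^sup>2 \<le> (real (?u choose p))\<^sup>2"
    by (intro power_mono) auto
  then have binom: "real t ^ (2 * p) \<le> (real (?u choose p))\<^sup>2"
    by (simp add: power_mult[symmetric] mult.commute)
  \<comment> \<open>The threshold \<open>?z\<close> is \<open>?n\<close> divided by the word length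
    \<open>2 * ?u\<close>, so dependent letters cost only a factor \<open>exp 1\<close> overall.
    This is the source of the 3 in \<open>energy\<close>.\<close>
  have "1 + 1 / (2 * real p * real t) \<le> exp (1 / (2 * real p * real t))"
    by (rule exp_ge_add_one_self)
  then have "(1 + 1 / (2 * real p * real t)) ^ (2 * ?u) \<le> exp (1 / (2 * real p * real t)) ^ (2 * ?u)"
    by (intro power_mono) auto
  also have "\<dots> = exp 1"
    using t p by (simp add: exp_of_nat_mult[symmetric])
  also have "\<dots> \<le> 3" by (rule exp_le)
  finally have three: "(1 + 1 / (2 * real p * real t)) ^ (2 * ?u) \<le> 3" .
  have "?n + ?z = ?n * (1 + 1 / (2 * real p * real t))"
    by (simp add: algebra_simps)
  then have "(?n + ?z) ^ (2 * ?u) \<le> ?n ^ (2 * ?u) * 3"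
    using three by (simp add: power_mult_distrib mult_left_mono)
  also have "?n ^ (2 * ?u) = ?n ^ (2 * (?u - p)) * ?n ^ (2 * p)"
  proof -
    have "p \<le> p * t" using t by simp
    then have "2 * ?u = 2 * (?u - p) + 2 * p"
      by (metis distrib_left le_add_diff_inverse2)
    then show ?thesis by (simp only: power_add[symmetric])
  qed
  finally have upper: "(?n + ?z) ^ (2 * ?u) \<le> ?n ^ (2 * (?u - p)) * (3 * ?n ^ (2 * p))"
    by simp
  have "?n ^ (2 * (?u - p)) * (3 * ?n ^ (2 * p))
      < ?n ^ (2 * (?u - p)) * (real t ^ (2 * p) * real (word_energy p A))"
    using energy n by (intro mult_strict_left_mono) auto
  also have "\<dots> \<le> ?n ^ (2 * (?u - p)) * ((real (?u choose p))\<^sup>2 * real (word_energy p A))"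
    using binom by (intro mult_left_mono mult_right_mono) auto
  also have "\<dots> \<le> (?n + ?z) ^ (2 * ?u)"
    using le by (simp add: mult_ac)
  finally show False using upper by simp
qed

text \<open>The set is \<open>A \<inter> signed_span R (4 * p)\<close> with \<open>R\<close> from
  \<open>large_span_intersection\<close>. The constants are 18 = 2 * 9, from
  \<open>t \<le> 9 * r\<close>, and 252 = 2 * 18 * 7, from the dimension bound.\<close>

lemma corollary_bounds:
  fixes k :: nat and c :: real
  assumes A: "finite A" "A \<subseteq> carrier G" and k: "2 \<le> k" "int k < \<lfloor>log 2 (real (card A))\<rfloor>"
    and T: "real (T_energy G k A) = c * real (card A) ^ (2 * k - 1)"
  shows "\<exists>A' \<subseteq> A.
     real (card A') \<ge>
       1 / 18 * (c powr (1 / (real k - 1)) * real (card A) / log 2 (real (card A)) ^ 3)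
          * log 2 (c powr (1 / (real k - 1)) * real (card A)) \<and>
     real (add_dim G A') \<le>
       252 * c powr (- (1 / (2 * (real k - 1)))) * log 2 (real (card A)) powr (3 / 2)"
proof -
  define n where "n = real (card A)"
  define L where "L = log 2 n"
  define p where "p = nat \<lfloor>L\<rfloor>"
  define s where "s = c powr (1 / (real k - 1))"
  \<comment> \<open>With \<open>K = 1 / s\<close> we have \<open>r = sqrt K\<close>; log-convexity gives
    \<open>T\<^sub>p \<ge> (n / K)\<^bsup>p - 1\<^esup> n\<^bsup>p\<^esup>\<close>, which beats the bound for free words once \<open>t\<close> is a
    large multiple of \<open>sqrt K\<close>.\<close>
  define r where "r = c powr (- (1 / (2 * (real k - 1))))"
  have k1: "real k - 1 > 0" using k by simp
  have p: "k < p" "real p \<le> L" "L < real p + 1"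
    using k by (auto simp: p_def L_def n_def) linarith+
  have L: "L \<ge> 3" using p k by linarith
  have n: "n > 1"
  proof (rule ccontr)
    assume "\<not> n > 1"
    then have "log 2 n \<le> 0"
      by (cases "n = 0") (auto simp: n_def log_def divide_le_0_iff)
    then show False using L by (simp add: L_def)
  qed
  have nL: "n = 2 powr L" using n by (simp add: L_def)
  have ne: "A \<noteq> {}" using n by (auto simp: n_def)
  have E: "real (word_energy k A) = c * n ^ (2 * k - 1)"
    using T T_energy_eq_word_energy[OF A(2,1), of k] by (simp add: n_def)
  have c: "c > 0"
    using word_energy_pos[OF A(1) ne, of k] E n by (smt (verit) of_nat_0_less_iff zero_less_mult_iff zero_less_power)
  have s: "s > 0" and r: "r > 0" using c by (auto simp: s_def r_def)
  have s_pow: "s ^ (k - 1) = c"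
    using c k k1 by (simp add: s_def powr_power of_nat_diff)
  have rs: "r\<^sup>2 * s = 1"
  proof -
    have "r\<^sup>2 = c powr (- (1 / (real k - 1)))"
    proof -
      have "r\<^sup>2 = c powr (real 2 * - (1 / (2 * (real k - 1))))"
        unfolding r_def using c by (subst powr_power) auto
      also have "real 2 * - (1 / (2 * (real k - 1))) = - (1 / (real k - 1))"
        using k1 by (simp add: divide_simps)
      finally show ?thesis .
    qed
    then show ?thesis unfolding s_def using c by (simp add: powr_add[symmetric])
  qed
  have E_le: "real (word_energy k A) \<le> n ^ (2 * k - 1)"
  proof -
    have "word_energy k A \<le> card A ^ (2 * k - 1)"
    proof -
      have "Suc (k - 1) = k" "2 * (k - 1) + 1 = 2 * k - 1"
        using k by auto
      then show ?thesis
        using word_energy_Suc_le[OF A, of "k - 1"] by (simp only:)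
    qed
    then show ?thesis unfolding n_def by (metis of_nat_le_iff of_nat_power)
  qed
  have c1: "c \<le> 1"
    using E_le E n by (simp add: mult_le_cancel_right1)
  have r1: "r \<ge> 1"
    unfolding r_def using c c1 k1 by (simp add: powr_minus_divide powr_le1)
  have s1: "s \<le> 1"
    unfolding s_def using c c1 k1 by (intro powr_le1) auto
  \<comment> \<open>The factor 8 makes \<open>(8 * r) ^ (2 * p) * s ^ p\<close> equal to
    \<open>64 ^ p\<close>. Rounding up costs at most \<open>r\<close>, as
    \<open>r \<ge> 1\<close>.\<close>
  define t where "t = nat \<lceil>8 * r\<rceil>"
  have t: "8 * r \<le> real t" "real t \<le> 9 * r"
    using r1 by (auto simp: t_def) linarith+
  have t1: "t \<ge> 1" and p1: "p \<ge> 1" using t r1 p k by linarith+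
  have growth: "real (word_energy k A) ^ (p - 1) \<le> real (word_energy p A) ^ (k - 1) * n ^ (p - k)"
    using word_energy_growth[OF A ne, of k p] k p unfolding n_def
    by (metis (no_types, lifting) le_trans less_imp_le of_nat_le_iff of_nat_mult of_nat_power one_le_numeral)
  \<comment> \<open>The wanted lower bound for the energy of order \<open>p\<close>, raised to the
    power \<open>k - 1\<close> and multiplied by \<open>n ^ (p - k)\<close>, is exactly the left
    side of \<open>growth\<close>. Cancelling and taking the root then gives
    \<open>Ep\<close>.\<close>
  have "(s ^ (p - 1) * n ^ (2 * p - 1)) ^ (k - 1) * n ^ (p - k)
      = c ^ (p - 1) * (n ^ (2 * k - 1)) ^ (p - 1)"
  proof -
    have e: "(2 * p - 1) * (k - 1) + (p - k) = (2 * k - 1) * (p - 1)"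
    proof -
      obtain a b where "k = Suc a" "p = Suc (a + b)"
        using p k by (metis Suc_pred' add_Suc le_add_diff_inverse less_imp_le zero_less_numeral less_le_trans)
      then show ?thesis by (simp add: algebra_simps)
    qed
    have "(s ^ (p - 1)) ^ (k - 1) = c ^ (p - 1)"
      by (simp add: s_pow[symmetric] power_mult[symmetric] mult.commute)
    then show ?thesis
      by (simp only: power_mult_distrib power_mult[symmetric] mult.assoc power_add[symmetric] e)
  qed
  also have "\<dots> \<le> real (word_energy p A) ^ (k - 1) * n ^ (p - k)"
    using growth unfolding E by (simp add: power_mult_distrib)
  finally have "(s ^ (p - 1) * n ^ (2 * p - 1)) ^ (k - 1) \<le> real (word_energy p A) ^ (k - 1)"
    using n by simp
  then have Ep: "s ^ (p - 1) * n ^ (2 * p - 1) \<le> real (word_energy p A)"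
  proof -
    have "k - 1 = Suc (k - 2)" using k by auto
    with \<open>(s ^ (p - 1) * n ^ (2 * p - 1)) ^ (k - 1) \<le> _\<close>
    have "(s ^ (p - 1) * n ^ (2 * p - 1)) ^ Suc (k - 2) \<le> real (word_energy p A) ^ Suc (k - 2)"
      by (simp only:)
    then show ?thesis by (rule power_le_imp_le_base) simp
  qed
  have n4: "n \<le> 4 ^ p"
  proof -
    have "n \<le> 2 powr (real p + 1)" unfolding nL using p by (intro powr_mono) auto
    also have "\<dots> \<le> 2 powr (2 * real p)" using p1 by (intro powr_mono) auto
    also have "\<dots> = 4 ^ p" by (simp add: powr_powr[symmetric] powr_realpow)
    finally show ?thesis .
  qed
  \<comment> \<open>The lower bound \<open>Ep\<close> has one factor \<open>n\<close> too few. Both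
    it and the 3 are absorbed, since \<open>3 < 4 ^ p\<close>, \<open>n \<le> 4 ^ p\<close> and
    \<open>16 ^ p \<le> 64 ^ p\<close>.\<close>
  have "3 * n ^ (2 * p) < real t ^ (2 * p) * real (word_energy p A)"
  proof -
    have "(3::real) < 4 ^ p"
      using power_increasing[of 1 p "4 :: real"] p1 by simp
    then have "3 * n < 4 ^ p * 4 ^ p"
      using n n4 by (intro mult_less_le_imp_less) auto
    also have "\<dots> = 16 ^ p" by (simp add: power_mult_distrib[symmetric])
    also have "\<dots> \<le> 64 ^ p" by (intro power_mono) auto
    finally have "3 * n < 64 ^ p" .
    then have "3 * n * n ^ (2 * p - 1) < 64 ^ p * n ^ (2 * p - 1)"
      using n by (intro mult_strict_right_mono) auto
    then have "3 * n ^ (2 * p) < 64 ^ p * n ^ (2 * p - 1)"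
      using p1 by (cases p) (auto simp: mult_ac)
    also have "\<dots> = (8 * r) ^ (2 * p) * (s ^ p * n ^ (2 * p - 1))"
    proof -
      have "(8 * r) ^ (2 * p) * s ^ p = 64 ^ p * (r\<^sup>2 * s) ^ p"
        by (simp add: power_mult_distrib power_mult)
      then show ?thesis using rs by (simp add: mult.assoc[symmetric])
    qed
    also have "\<dots> \<le> (8 * r) ^ (2 * p) * (s ^ (p - 1) * n ^ (2 * p - 1))"
      using r n s s1 by (intro mult_left_mono mult_right_mono power_decreasing) auto
    also have "\<dots> \<le> real t ^ (2 * p) * real (word_energy p A)"
      using t r n s Ep by (intro mult_mono power_mono) auto
    finally show ?thesis .
  qed
  then obtain R where R: "set R \<subseteq> carrier G" "length R \<le> 2 * (p * t)"
    and size: "n / (2 * real p * real t) \<le> real (card (A \<inter> signed_span R (4 * p)))"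
    using large_span_intersection[OF A ne t1 p1] unfolding n_def by blast
  have pt: "real p * real t \<le> L * (9 * r)"
    using p t L by (intro mult_mono) auto
  \<comment> \<open>The span supplies \<open>n / (2 * p * t)\<close>, at least
    \<open>n / (18 * r * L)\<close>. The claimed size is smaller because
    \<open>log 2 (s * n) \<le> L\<close>, \<open>L \<ge> 1\<close> and
    \<open>s * r \<le> 1\<close>.\<close>
  have size': "1 / 18 * (s * n / L ^ 3) * log 2 (s * n) \<le> real (card (A \<inter> signed_span R (4 * p)))"
  proof -
    have "log 2 (s * n) \<le> L"
      unfolding L_def using s s1 n by (subst log_le_cancel_iff) auto
    then have "1 / 18 * (s * n / L ^ 3) * log 2 (s * n) \<le> 1 / 18 * (s * n / L ^ 3) * L"
      using s n L by (intro mult_left_mono) auto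
    also have "\<dots> = (s * n / 18) * (1 / L\<^sup>2)"
      using L by (simp add: power2_eq_square power3_eq_cube)
    also have "\<dots> \<le> (s * n / 18) * (1 / L)"
      using s n L by (intro mult_left_mono divide_left_mono) (auto simp: power2_eq_square)
    also have "\<dots> \<le> n / (18 * r * L)"
    proof -
      have "s * r \<le> r\<^sup>2 * s" using r1 s by (simp add: power2_eq_square)
      then have "s * r \<le> 1" using rs by simp
      then have "s * r * n \<le> 1 * n" using n by (intro mult_right_mono) auto
      then show ?thesis using r L by (simp add: field_simps)
    qed
    also have "\<dots> \<le> n / (2 * real p * real t)"
      using pt n p1 t1 L r by (intro divide_left_mono) auto
    finally show ?thesis using size by simp
  qed
  have dim: "real (add_dim G (A \<inter> signed_span R (4 * p))) \<le> 252 * r * L powr (3 / 2)"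
  proof -
    have "real (add_dim G (A \<inter> signed_span R (4 * p))) \<le> 2 * real (length R) * log 2 (8 * real (4 * p))"
      using A R p1 by (intro add_dim_signed_span_le) auto
    also have "\<dots> \<le> 2 * (18 * r * L) * (7 * sqrt L)"
    proof (intro mult_mono)
      have "real (length R) \<le> 2 * (real p * real t)"
        using R(2) by (metis of_nat_le_iff of_nat_mult of_nat_numeral)
      then show "real (length R) \<le> 18 * r * L" using pt by (simp add: algebra_simps)
      \<comment> \<open>The logarithm is estimated by \<open>sqrt L\<close>, which produces the
        exponent 3/2: \<open>5 \<le> 3 * sqrt L\<close> because \<open>L \<ge> 3\<close>, and
        \<open>2 * log 2 (sqrt L) \<le> 4 * sqrt L\<close>.\<close>
      have "log 2 (8 * real (4 * p)) \<le> log 2 (32 * L)"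
        using p p1 by (subst log_le_cancel_iff) auto
      also have "\<dots> = 5 + log 2 L"
      proof -
        have "log 2 (32::real) = 5" using log_nat_power[of 2 2 5] by simp
        then show ?thesis using L by (simp add: log_mult)
      qed
      also have "log 2 L = 2 * log 2 (sqrt L)"
      proof -
        have "log 2 ((sqrt L)\<^sup>2) = real 2 * log 2 (sqrt L)"
          by (rule log_nat_power) (use L in auto)
        then show ?thesis using L by simp
      qed
      also have "log 2 (sqrt L) \<le> 2 * sqrt L"
      proof -
        have "ln (1 / 2 :: real) \<le> 1 / 2 - 1" by (rule ln_le_minus_one) simp
        then have "1 \<le> 2 * ln (2 :: real)" by (simp add: ln_div)
        have "ln (sqrt L) \<le> sqrt L - 1" using L by (intro ln_le_minus_one) simp
        also have "\<dots> \<le> 1 * sqrt L" by simp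
        also have "\<dots> \<le> (2 * ln 2) * sqrt L"
          using \<open>1 \<le> 2 * ln 2\<close> L by (intro mult_right_mono) auto
        finally show ?thesis by (simp add: log_def field_simps)
      qed
      also have "5 \<le> 3 * sqrt L"
        using L real_le_rsqrt[of "5 / 3" L] by (simp add: power2_eq_square)
      finally show "log 2 (8 * real (4 * p)) \<le> 7 * sqrt L" by simp
    qed (use r L p1 in auto)
    also have "\<dots> = 252 * r * L powr (3 / 2)"
    proof -
      have "L powr (3 / 2) = L powr (1 + 1 / 2)" by simp
      also have "\<dots> = L * sqrt L" using L by (subst powr_add) (simp add: powr_half_sqrt)
      finally show ?thesis by simp
    qed
    finally show ?thesis .
  qed
  show ?thesis
    using size' dim unfolding s_def r_def L_def n_def
    by (intro exI[of _ "A \<inter> signed_span R (4 * p)"]) auto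
qed

end

section \<open>Transfer along injective homomorphisms\<close>

lemma finprod_hom:
  assumes "comm_group G" "comm_group H" "\<phi> \<in> hom G H" "f \<in> B \<rightarrow> carrier G"
  shows "\<phi> (finprod G f B) = finprod H (\<lambda>x. \<phi> (f x)) B"
proof -
  interpret G: comm_group G by fact
  interpret H: comm_group H by fact
  have one: "\<phi> \<one>\<^bsub>G\<^esub> = \<one>\<^bsub>H\<^esub>"
    using assms(3) hom_one G.is_group H.is_group by blast
  show ?thesis
    using assms(4)
  proof (induction B rule: infinite_finite_induct)
    case (insert b B)
    then have b: "f b \<in> carrier G" "f \<in> B \<rightarrow> carrier G" by auto
    then have "\<phi> (f b) \<in> carrier H" "(\<lambda>x. \<phi> (f x)) \<in> B \<rightarrow> carrier H"
      using hom_in_carrier[OF assms(3)] by auto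
    with b insert show ?case
      using assms(3) by (simp add: hom_mult)
  qed (auto simp: one)
qed

lemma word_prod_hom:
  assumes "comm_group G" "comm_group H" "\<phi> \<in> hom G H" "set w \<subseteq> carrier G"
  shows "foldr (\<otimes>\<^bsub>H\<^esub>) (map \<phi> w) \<one>\<^bsub>H\<^esub> = \<phi> (foldr (\<otimes>\<^bsub>G\<^esub>) w \<one>\<^bsub>G\<^esub>)"
proof -
  interpret G: comm_group G by fact
  interpret H: comm_group H by fact
  have "\<phi> \<one>\<^bsub>G\<^esub> = \<one>\<^bsub>H\<^esub>"
    using assms(3) hom_one G.is_group H.is_group by blast
  then show ?thesis
    using assms(4) by (induction w) (auto simp: hom_mult[OF assms(3)] G.word_prod_closed)
qed

text \<open>Words over \<open>A\<close> correspond bijectively to words over the image, and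
  injectivity on the whole carrier preserves both equality and inequality of their products.\<close>

lemma T_energy_image:
  assumes G: "comm_group G" and H: "comm_group H" and \<phi>: "\<phi> \<in> hom G H" "inj_on \<phi> (carrier G)"
    and A: "finite A" "A \<subseteq> carrier G"
  shows "T_energy H k (\<phi> ` A) = T_energy G k A"
proof -
  interpret G: comm_group G by fact
  interpret H: comm_group H by fact
  let ?L = "listset (replicate k A)"
  have inj: "inj_on \<phi> A" using \<phi>(2) A(2) by (rule inj_on_subset)
  have img: "listset (replicate k (\<phi> ` A)) = map \<phi> ` ?L"
  proof (intro equalityI subsetI)
    fix w assume "w \<in> listset (replicate k (\<phi> ` A))"
    then have "w \<in> lists (\<phi> ` A)" "length w = k" by (auto simp: listset_replicate)
    then obtain v where "v \<in> lists A" "w = map \<phi> v" unfolding lists_image by blast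
    with \<open>length w = k\<close> show "w \<in> map \<phi> ` ?L" by (auto simp: listset_replicate lists_eq_set)
  next
    fix w assume "w \<in> map \<phi> ` ?L"
    then obtain v where "set v \<subseteq> A" "length v = k" "w = map \<phi> v"
      by (auto simp: listset_replicate)
    then show "w \<in> listset (replicate k (\<phi> ` A))"
      by (simp add: listset_replicate image_mono)
  qed
  have inj_map: "inj_on (map \<phi>) ?L"
    by (rule inj_on_mapI, rule inj_on_subset[OF inj]) (auto simp: listset_replicate)
  have "H.word_energy k (\<phi> ` A) = (\<Sum>x\<in>?L. \<Sum>y\<in>?L.
      of_bool (H.word_prod (map \<phi> x) = H.word_prod (map \<phi> y)))"
    unfolding H.word_energy_def img sum.reindex[OF inj_map] o_def by (rule refl)
  also have "\<dots> = G.word_energy k A"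
    unfolding G.word_energy_def
  proof (intro sum.cong refl arg_cong[where f = of_bool])
    fix x y assume "x \<in> ?L" "y \<in> ?L"
    then have "set x \<subseteq> carrier G" "set y \<subseteq> carrier G"
      using A by (auto simp: listset_replicate)
    then show "H.word_prod (map \<phi> x) = H.word_prod (map \<phi> y) \<longleftrightarrow> G.word_prod x = G.word_prod y"
      using inj_onD[OF \<phi>(2)] G.word_prod_closed[of x] G.word_prod_closed[of y]
      by (auto simp: word_prod_hom[OF G H \<phi>(1)])
  qed
  finally have "H.word_energy k (\<phi> ` A) = G.word_energy k A" .
  moreover have "\<phi> ` A \<subseteq> carrier H"
    using A hom_in_carrier[OF \<phi>(1)] by auto
  ultimately show ?thesis
    using A by (simp add: G.T_energy_eq_word_energy H.T_energy_eq_word_energy)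
qed

lemma dissociated_image:
  assumes G: "comm_group G" and H: "comm_group H" and \<phi>: "\<phi> \<in> hom G H" "inj_on \<phi> (carrier G)"
    and D: "D \<subseteq> carrier G"
  shows "dissociated H (\<phi> ` D) \<longleftrightarrow> dissociated G D"
proof -
  interpret G: comm_group G by fact
  interpret H: comm_group H by fact
  have inj: "inj_on \<phi> D" using \<phi>(2) D by (rule inj_on_subset)
  have DH: "\<phi> ` D \<subseteq> carrier H"
    using D hom_in_carrier[OF \<phi>(1)] by auto
  have one: "\<phi> \<one>\<^bsub>G\<^esub> = \<one>\<^bsub>H\<^esub>"
    using \<phi>(1) hom_one G.is_group H.is_group by blast
  have prod: "finprod H (\<lambda>y. y [^]\<^bsub>H\<^esub> \<epsilon> y) (\<phi> ` D) = \<one>\<^bsub>H\<^esub>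
      \<longleftrightarrow> finprod G (\<lambda>x. x [^]\<^bsub>G\<^esub> \<epsilon> (\<phi> x)) D = \<one>\<^bsub>G\<^esub>" for \<epsilon> :: "_ \<Rightarrow> int"
  proof -
    have "finprod H (\<lambda>y. y [^]\<^bsub>H\<^esub> \<epsilon> y) (\<phi> ` D) = finprod H (\<lambda>x. \<phi> x [^]\<^bsub>H\<^esub> \<epsilon> (\<phi> x)) D"
      using inj DH by (intro H.finprod_reindex) auto
    also have "\<dots> = finprod H (\<lambda>x. \<phi> (x [^]\<^bsub>G\<^esub> \<epsilon> (\<phi> x))) D"
      using D DH by (intro H.finprod_cong') (auto simp: hom_int_pow[OF \<phi>(1) _ G.is_group H.is_group]
          intro!: hom_in_carrier[OF \<phi>(1)])
    also have "\<dots> = \<phi> (finprod G (\<lambda>x. x [^]\<^bsub>G\<^esub> \<epsilon> (\<phi> x)) D)"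
      using D by (intro finprod_hom[symmetric] G H \<phi>(1)) auto
    finally have eq: "finprod H (\<lambda>y. y [^]\<^bsub>H\<^esub> \<epsilon> y) (\<phi> ` D)
        = \<phi> (finprod G (\<lambda>x. x [^]\<^bsub>G\<^esub> \<epsilon> (\<phi> x)) D)" .
    have "finprod G (\<lambda>x. x [^]\<^bsub>G\<^esub> \<epsilon> (\<phi> x)) D \<in> carrier G"
      using D by (intro G.finprod_closed) auto
    then show ?thesis
      unfolding eq using inj_onD[OF \<phi>(2)] one by (metis G.one_closed)
  qed
  have "(\<forall>\<epsilon> :: _ \<Rightarrow> int. (\<forall>y\<in>\<phi> ` D. \<epsilon> y \<in> {-1, 0, 1}) \<longrightarrow>
        finprod H (\<lambda>y. y [^]\<^bsub>H\<^esub> \<epsilon> y) (\<phi> ` D) = \<one>\<^bsub>H\<^esub> \<longrightarrow> (\<forall>y\<in>\<phi> ` D. \<epsilon> y = 0))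
    \<longleftrightarrow> (\<forall>\<epsilon> :: _ \<Rightarrow> int. (\<forall>x\<in>D. \<epsilon> x \<in> {-1, 0, 1}) \<longrightarrow>
        finprod G (\<lambda>x. x [^]\<^bsub>G\<^esub> \<epsilon> x) D = \<one>\<^bsub>G\<^esub> \<longrightarrow> (\<forall>x\<in>D. \<epsilon> x = 0))" (is "?lhs \<longleftrightarrow> ?rhs")
  proof
    assume l: ?lhs
    show ?rhs
    proof (intro allI impI)
      fix \<epsilon> :: "_ \<Rightarrow> int"
      assume \<epsilon>: "\<forall>x\<in>D. \<epsilon> x \<in> {-1, 0, 1}" "finprod G (\<lambda>x. x [^]\<^bsub>G\<^esub> \<epsilon> x) D = \<one>\<^bsub>G\<^esub>"
      \<comment> \<open>A coefficient function on \<open>D\<close> becomes one on the image through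
        the inverse of \<open>\<phi>\<close> there.\<close>
      define \<delta> where "\<delta> y = \<epsilon> (inv_into D \<phi> y)" for y
      have \<delta>: "\<delta> (\<phi> x) = \<epsilon> x" if "x \<in> D" for x
        using inj that by (simp add: \<delta>_def)
      have "finprod G (\<lambda>x. x [^]\<^bsub>G\<^esub> \<delta> (\<phi> x)) D = finprod G (\<lambda>x. x [^]\<^bsub>G\<^esub> \<epsilon> x) D"
        using D \<delta> by (intro G.finprod_cong') auto
      then have "finprod H (\<lambda>y. y [^]\<^bsub>H\<^esub> \<delta> y) (\<phi> ` D) = \<one>\<^bsub>H\<^esub>"
        using prod[of \<delta>] \<epsilon>(2) by simp
      moreover have "\<forall>y\<in>\<phi> ` D. \<delta> y \<in> {-1, 0, 1}"
        using \<epsilon>(1) \<delta> by simp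
      ultimately have "\<forall>y\<in>\<phi> ` D. \<delta> y = 0"
        using l by blast
      then show "\<forall>x\<in>D. \<epsilon> x = 0"
        using \<delta> by simp
    qed
  next
    assume r: ?rhs
    show ?lhs
    proof (intro allI impI)
      fix \<delta> :: "_ \<Rightarrow> int"
      assume \<delta>: "\<forall>y\<in>\<phi> ` D. \<delta> y \<in> {-1, 0, 1}" "finprod H (\<lambda>y. y [^]\<^bsub>H\<^esub> \<delta> y) (\<phi> ` D) = \<one>\<^bsub>H\<^esub>"
      then have "finprod G (\<lambda>x. x [^]\<^bsub>G\<^esub> \<delta> (\<phi> x)) D = \<one>\<^bsub>G\<^esub>" "\<forall>x\<in>D. \<delta> (\<phi> x) \<in> {-1, 0, 1}"
        using prod[of \<delta>] by simp_all
      then have "\<forall>x\<in>D. \<delta> (\<phi> x) = 0"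
        using r[THEN spec[of _ "\<lambda>x. \<delta> (\<phi> x)"]] by blast
      then show "\<forall>y\<in>\<phi> ` D. \<delta> y = 0"
        by simp
    qed
  qed
  then show ?thesis
    using D DH inj unfolding dissociated_def by (simp only: finite_image_iff)
qed

lemma add_dim_image:
  assumes G: "comm_group G" and H: "comm_group H" and \<phi>: "\<phi> \<in> hom G H" "inj_on \<phi> (carrier G)"
    and B: "B \<subseteq> carrier G"
  shows "add_dim H (\<phi> ` B) = add_dim G B"
proof -
  have "{\<Lambda>. \<Lambda> \<subseteq> \<phi> ` B \<and> dissociated H \<Lambda>} = (`) \<phi> ` {D. D \<subseteq> B \<and> dissociated G D}"
  proof (intro equalityI subsetI)
    fix \<Lambda> assume \<Lambda>: "\<Lambda> \<in> {\<Lambda>. \<Lambda> \<subseteq> \<phi> ` B \<and> dissociated H \<Lambda>}"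
    then obtain D where "D \<subseteq> B" "\<Lambda> = \<phi> ` D" by (auto simp: subset_image_iff)
    then show "\<Lambda> \<in> (`) \<phi> ` {D. D \<subseteq> B \<and> dissociated G D}"
      using \<Lambda> B dissociated_image[OF G H \<phi>, of D] by auto
  next
    fix \<Lambda> assume "\<Lambda> \<in> (`) \<phi> ` {D. D \<subseteq> B \<and> dissociated G D}"
    then obtain D where "D \<subseteq> B" "\<Lambda> = \<phi> ` D" "dissociated G D" by auto
    then show "\<Lambda> \<in> {\<Lambda>. \<Lambda> \<subseteq> \<phi> ` B \<and> dissociated H \<Lambda>}"
      using B dissociated_image[OF G H \<phi>, of D] by auto
  qed
  moreover have "card (\<phi> ` D) = card D" if "D \<subseteq> B" for D
    using that B \<phi>(2) by (intro card_image) (auto intro: inj_on_subset)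
  ultimately have "card ` {\<Lambda>. \<Lambda> \<subseteq> \<phi> ` B \<and> dissociated H \<Lambda>} = card ` {D. D \<subseteq> B \<and> dissociated G D}"
    by (auto simp: image_image)
  then show ?thesis by (simp add: add_dim_def)
qed

section \<open>Reduction to groups on \<open>nat\<close>\<close>

text \<open>Every element of the generated subgroup is the product of a finite word in
  \<open>A\<close> and its inverses.\<close>

lemma (in comm_group) countable_generate:
  assumes "A \<subseteq> carrier G" "countable A"
  shows "countable (generate G A)"
proof -
  let ?S = "A \<union> m_inv G ` A"
  have S: "?S \<subseteq> carrier G" using assms by auto
  have app: "word_prod (v @ w) = word_prod v \<otimes> word_prod w"
    if "set v \<subseteq> carrier G" "set w \<subseteq> carrier G" for v w
    using that by (induction v) (auto simp: word_prod_closed m_assoc)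
  have "generate G A \<subseteq> word_prod ` lists ?S"
  proof
    fix x assume "x \<in> generate G A"
    then show "x \<in> word_prod ` lists ?S"
    proof induction
      case one
      then show ?case by (auto intro!: image_eqI[of _ _ "[]"])
    next
      case (incl h)
      then show ?case using S by (auto intro!: image_eqI[of _ _ "[h]"])
    next
      case (inv h)
      then show ?case using S by (auto intro!: image_eqI[of _ _ "[inv h]"])
    next
      case (eng h1 h2)
      then obtain v w where "v \<in> lists ?S" "w \<in> lists ?S" "h1 = word_prod v" "h2 = word_prod w"
        by blast
      moreover from this have "set v \<subseteq> carrier G" "set w \<subseteq> carrier G"
        using S by (auto simp: lists_eq_set simp del: Un_iff)
      ultimately show ?case
        using app[of v w] by (intro image_eqI[of _ _ "v @ w"]) auto
    qed
  qed
  then show ?thesis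
    using assms by (auto intro: countable_subset)
qed

text \<open>The group structure is transported along an injection into \<open>nat\<close>, with its
  image as carrier.\<close>

lemma countable_comm_group_nat_copy:
  assumes K: "comm_group K" and "countable (carrier K)"
  shows "\<exists>(H :: nat monoid) \<psi>. comm_group H \<and> \<psi> \<in> hom K H \<and> inj_on \<psi> (carrier K)"
proof -
  interpret K: comm_group K by fact
  define \<psi> where "\<psi> = to_nat_on (carrier K)"
  define \<xi> where "\<xi> = inv_into (carrier K) \<psi>"
  define H :: "nat monoid" where
    "H = \<lparr>carrier = \<psi> ` carrier K, monoid.mult = (\<lambda>m n. \<psi> (\<xi> m \<otimes>\<^bsub>K\<^esub> \<xi> n)), one = \<psi> \<one>\<^bsub>K\<^esub>\<rparr>"
  have inj: "inj_on \<psi> (carrier K)"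
    unfolding \<psi>_def using assms(2) by (rule inj_on_to_nat_on)
  then have \<xi>: "\<xi> (\<psi> x) = x" if "x \<in> carrier K" for x
    using that by (simp add: \<xi>_def)
  have "comm_group H"
  proof (rule comm_groupI)
    fix x assume "x \<in> carrier H"
    then obtain a where "a \<in> carrier K" "x = \<psi> a" by (auto simp: H_def)
    then show "\<exists>y\<in>carrier H. y \<otimes>\<^bsub>H\<^esub> x = \<one>\<^bsub>H\<^esub>"
      by (auto simp: H_def \<xi> intro!: bexI[of _ "inv\<^bsub>K\<^esub> a"])
  qed (auto simp: H_def \<xi> K.m_ac)
  moreover have "\<psi> \<in> hom K H"
    by (auto simp: hom_def H_def \<xi>)
  ultimately show ?thesis using inj by blast
qed

text \<open>The subgroup \<open>?K\<close> generated by \<open>A\<close> embeds both in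
  \<open>G\<close> and in a group \<open>H\<close> on \<open>nat\<close>. Energies and dimensions in
  \<open>G\<close> and \<open>H\<close> are compared through \<open>?K\<close>, since
  \<open>\<psi>\<close> is defined as a homomorphism only on \<open>?K\<close>.\<close>

lemma bounds_hold_transfer:
  assumes nat: "bounds_hold TYPE(nat) c0 C"
  shows "bounds_hold TYPE('a) c0 C"
  unfolding bounds_hold_def
proof (intro allI impI)
  fix G :: "'a monoid" and A :: "'a set" and k :: nat and c :: real
  assume G: "comm_group G" and A: "A \<subseteq> carrier G" "finite A" and k: "2 \<le> k"
    and hyps: "int k < \<lfloor>log 2 (real (card A))\<rfloor>"
      "real (T_energy G k A) = c * real (card A) ^ (2 * k - 1)"
      "10 ^ k * real (card A) ^ k * log 2 (real (card A)) ^ (2 * k) \<le> c * real (card A) ^ (2 * k - 1)"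
  interpret G: comm_group G by fact
  let ?K = "subgroup_generated G A"
  have K: "comm_group ?K"
    by (rule G.abelian_subgroup_generated[OF G])
  have AK: "A \<subseteq> carrier ?K"
    using A by (simp add: carrier_subgroup_generated generate.incl subset_iff)
  \<comment> \<open>Viewing the inclusion as an injective homomorphism lets the image lemmas also
    compare \<open>?K\<close> with \<open>G\<close>.\<close>
  have incl: "(\<lambda>x. x) \<in> hom ?K G" "inj_on (\<lambda>x. x) (carrier ?K)"
    using G.carrier_subgroup_generated_subset[of A] by (auto simp: hom_def)
  have "carrier G \<inter> A = A" using A by auto
  then have "countable (carrier ?K)"
    using A G.countable_generate[of A] by (simp add: carrier_subgroup_generated countable_finite)
  then obtain H :: "nat monoid" and \<psi> where H: "comm_group H" and \<psi>: "\<psi> \<in> hom ?K H" "inj_on \<psi> (carrier ?K)"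
    using countable_comm_group_nat_copy[OF K] by blast
  have card: "card (\<psi> ` B) = card B" if "B \<subseteq> A" for B
    using that AK \<psi>(2) by (intro card_image) (auto intro: inj_on_subset)
  have "T_energy H k (\<psi> ` A) = T_energy G k A"
    using T_energy_image[OF K H \<psi> A(2) AK] T_energy_image[OF K G incl A(2) AK] by simp
  moreover have "\<psi> ` A \<subseteq> carrier H"
    using AK hom_in_carrier[OF \<psi>(1)] by auto
  ultimately obtain A'' where A'': "A'' \<subseteq> \<psi> ` A"
      "c0 * (c powr (1 / (real k - 1)) * real (card A) / log 2 (real (card A)) ^ 3)
        * log 2 (c powr (1 / (real k - 1)) * real (card A)) \<le> real (card A'')"
      "real (add_dim H A'')
        \<le> C k * c powr (- (1 / (2 * (real k - 1)))) * log 2 (real (card A)) powr (3 / 2)"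
    using nat[unfolded bounds_hold_def, rule_format, of H "\<psi> ` A" k c] H A(2) k hyps card[of A]
    by auto
  then obtain A' where A': "A' \<subseteq> A" "A'' = \<psi> ` A'"
    by (auto simp: subset_image_iff)
  have "A' \<subseteq> carrier ?K" using A' AK by blast
  then have "add_dim H A'' = add_dim G A'"
    unfolding A'(2) using add_dim_image[OF K H \<psi>] add_dim_image[OF K G incl] by simp
  with A' A'' card[of A'] show "\<exists>A'\<subseteq>A.
      real (card A') \<ge> c0 * (c powr (1 / (real k - 1)) * real (card A) / log 2 (real (card A)) ^ 3)
        * log 2 (c powr (1 / (real k - 1)) * real (card A)) \<and>
      real (add_dim G A')
        \<le> C k * c powr (- (1 / (2 * (real k - 1)))) * log 2 (real (card A)) powr (3 / 2)"
    by (intro exI[of _ A']) auto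
qed

theorem corollary31:
  "(\<exists>c0 > 0. \<exists>C. (\<forall>k \<ge> 2. C k > 0) \<and> bounds_hold TYPE(nat) c0 C) \<and>
   (\<forall>c0 C. bounds_hold TYPE(nat) c0 C \<longrightarrow> bounds_hold TYPE('a) c0 C)"
proof
  \<comment> \<open>The dimension constant does not vary with \<open>k\<close>, so a constant
    function serves as \<open>C\<close>.\<close>
  have "bounds_hold TYPE(nat) (1 / 18) (\<lambda>_. 252)"
    unfolding bounds_hold_def using comm_group.corollary_bounds by blast
  then show "\<exists>c0 > 0. \<exists>C. (\<forall>k \<ge> 2. C k > 0) \<and> bounds_hold TYPE(nat) c0 C"
    by (intro exI[of _ "1 / 18"] conjI exI[of _ "\<lambda>_. 252"]) auto
next
  show "\<forall>c0 C. bounds_hold TYPE(nat) c0 C \<longrightarrow> bounds_hold TYPE('a) c0 C"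
    using bounds_hold_transfer by blast
qed

end
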